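(* $\mathsf{RCA}_0 \vdash \mathsf{EM} \rightarrow [\mathsf{STS}(2) \vee \mathsf{COH}]$.
   Context: $\mathsf{RCA}_0$ is the usual base system of reverse mathematics (second-order arithmetic with $\Delta^0_1$-comprehension and $\Sigma^0_1$-induction). A tournament $T$ on a domain $D\subseteq\mathbb{N}$ is an irreflexive binary relation on $D$ such that for all $x\ne y$ in $D$ exactly one of $T(x,y)$, $T(y,x)$ holds. It is transitive if the relation is transitive. $\mathsf{EM}$ is the statement "every infinite tournament has an infinite transitive subtournament". $f:[\mathbb{N}]^2\to\mathbb{N}$ (defined on pairs $x<s$) is stable if $\lim_s f(x,s)$ exists for every $x$. A set $A$ is thin for $f$ if $f([A]^2)\neq\mathbb{N}$. $\mathsf{STS}(2)$ is the statement "every stable $f:[\mathbb{N}]^2\to\mathbb{N}$ has an infinite set thin for $f$". $\mathsf{COH}$ (cohesiveness) is the statement "for every sequence of sets $R_0,R_1,\dots$ there is an infinite set $C$ such that for every $i$, either all but finitely many elements of $C$ are in $R_i$, or all but finitely many elements of $C$ are in $\overline{R_i}$". *)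

theory Defs
  imports Main
begin

section \<open>The language of second-order arithmetic\<close>

text \<open>Number variables and set variables are de Bruijn indices, in two separate index spaces:
  a number quantifier binds number index 0 and leaves set indices alone, and vice versa.
  As usual in second-order arithmetic, the only set terms are variables and equality is
  primitive for numbers only.\<close>

datatype tm = Var nat | Zero | One | Add tm tm | Mul tm tm

datatype fm =
    Eq tm tm (infix "\<^bold>=" 70)
  | Less tm tm (infix "\<^bold><" 70)
  | Mem tm nat (infix "\<^bold>\<in>" 70)
  | Falsum ("\<^bold>\<bottom>")
  | Imp fm fm (infixr "\<^bold>\<longrightarrow>" 55)
  | AllN fm ("\<^bold>\<forall>\<^sub>N _" [62] 62)
  | AllS fm ("\<^bold>\<forall>\<^sub>S _" [62] 62)

abbreviation Neg :: "fm \<Rightarrow> fm" ("\<^bold>\<not> _" [65] 65) where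
  "\<^bold>\<not> p \<equiv> p \<^bold>\<longrightarrow> \<^bold>\<bottom>"

abbreviation Or :: "fm \<Rightarrow> fm \<Rightarrow> fm" (infixr "\<^bold>\<or>" 57) where
  "p \<^bold>\<or> q \<equiv> \<^bold>\<not> p \<^bold>\<longrightarrow> q"

abbreviation And :: "fm \<Rightarrow> fm \<Rightarrow> fm" (infixr "\<^bold>\<and>" 58) where
  "p \<^bold>\<and> q \<equiv> \<^bold>\<not> (p \<^bold>\<longrightarrow> \<^bold>\<not> q)"

abbreviation Iff :: "fm \<Rightarrow> fm \<Rightarrow> fm" (infix "\<^bold>\<longleftrightarrow>" 54) where
  "p \<^bold>\<longleftrightarrow> q \<equiv> (p \<^bold>\<longrightarrow> q) \<^bold>\<and> (q \<^bold>\<longrightarrow> p)"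

abbreviation ExN :: "fm \<Rightarrow> fm" ("\<^bold>\<exists>\<^sub>N _" [62] 62) where
  "\<^bold>\<exists>\<^sub>N p \<equiv> \<^bold>\<not> (\<^bold>\<forall>\<^sub>N (\<^bold>\<not> p))"

abbreviation ExS :: "fm \<Rightarrow> fm" ("\<^bold>\<exists>\<^sub>S _" [62] 62) where
  "\<^bold>\<exists>\<^sub>S p \<equiv> \<^bold>\<not> (\<^bold>\<forall>\<^sub>S (\<^bold>\<not> p))"

abbreviation v :: "nat \<Rightarrow> tm" where "v \<equiv> Var"

subsection \<open>Simultaneous substitution\<close>

primrec subst_tm :: "(nat \<Rightarrow> tm) \<Rightarrow> tm \<Rightarrow> tm" where
  "subst_tm \<sigma> (Var n) = \<sigma> n"
| "subst_tm \<sigma> Zero = Zero"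
| "subst_tm \<sigma> One = One"
| "subst_tm \<sigma> (Add s t) = Add (subst_tm \<sigma> s) (subst_tm \<sigma> t)"
| "subst_tm \<sigma> (Mul s t) = Mul (subst_tm \<sigma> s) (subst_tm \<sigma> t)"

definition lift_tm :: "tm \<Rightarrow> tm" where
  "lift_tm = subst_tm (\<lambda>n. Var (Suc n))"

primrec subst :: "(nat \<Rightarrow> tm) \<Rightarrow> (nat \<Rightarrow> nat) \<Rightarrow> fm \<Rightarrow> fm" where
  "subst \<sigma> \<rho> (s \<^bold>= t) = (subst_tm \<sigma> s \<^bold>= subst_tm \<sigma> t)"
| "subst \<sigma> \<rho> (s \<^bold>< t) = (subst_tm \<sigma> s \<^bold>< subst_tm \<sigma> t)"
| "subst \<sigma> \<rho> (t \<^bold>\<in> X) = (subst_tm \<sigma> t \<^bold>\<in> \<rho> X)"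
| "subst \<sigma> \<rho> \<^bold>\<bottom> = \<^bold>\<bottom>"
| "subst \<sigma> \<rho> (p \<^bold>\<longrightarrow> q) = (subst \<sigma> \<rho> p \<^bold>\<longrightarrow> subst \<sigma> \<rho> q)"
| "subst \<sigma> \<rho> (\<^bold>\<forall>\<^sub>N p) = \<^bold>\<forall>\<^sub>N (subst (case_nat (Var 0) (\<lambda>n. lift_tm (\<sigma> n))) \<rho> p)"
| "subst \<sigma> \<rho> (\<^bold>\<forall>\<^sub>S p) = \<^bold>\<forall>\<^sub>S (subst \<sigma> (case_nat 0 (\<lambda>n. Suc (\<rho> n))) p)"

definition liftN :: "fm \<Rightarrow> fm" where "liftN = subst (\<lambda>n. Var (Suc n)) id"
definition liftS :: "fm \<Rightarrow> fm" where "liftS = subst Var Suc"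

text \<open>Instantiation removes index 0 and shifts the remaining indices down.\<close>

definition instN :: "fm \<Rightarrow> tm \<Rightarrow> fm" where "instN p t = subst (case_nat t Var) id p"
definition instS :: "fm \<Rightarrow> nat \<Rightarrow> fm" where "instS p X = subst Var (case_nat X id) p"

subsection \<open>Universal closure\<close>

text \<open>All free number (set) indices of \<open>p\<close> are below \<open>boundN p\<close> (\<open>boundS p\<close>).\<close>

primrec bound_tm :: "tm \<Rightarrow> nat" where
  "bound_tm (Var n) = Suc n"
| "bound_tm Zero = 0"
| "bound_tm One = 0"
| "bound_tm (Add s t) = max (bound_tm s) (bound_tm t)"
| "bound_tm (Mul s t) = max (bound_tm s) (bound_tm t)"

primrec boundN :: "fm \<Rightarrow> nat" where
  "boundN (s \<^bold>= t) = max (bound_tm s) (bound_tm t)"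
| "boundN (s \<^bold>< t) = max (bound_tm s) (bound_tm t)"
| "boundN (t \<^bold>\<in> X) = bound_tm t"
| "boundN \<^bold>\<bottom> = 0"
| "boundN (p \<^bold>\<longrightarrow> q) = max (boundN p) (boundN q)"
| "boundN (\<^bold>\<forall>\<^sub>N p) = boundN p - 1"
| "boundN (\<^bold>\<forall>\<^sub>S p) = boundN p"

primrec boundS :: "fm \<Rightarrow> nat" where
  "boundS (s \<^bold>= t) = 0"
| "boundS (s \<^bold>< t) = 0"
| "boundS (t \<^bold>\<in> X) = Suc X"
| "boundS \<^bold>\<bottom> = 0"
| "boundS (p \<^bold>\<longrightarrow> q) = max (boundS p) (boundS q)"
| "boundS (\<^bold>\<forall>\<^sub>N p) = boundS p"
| "boundS (\<^bold>\<forall>\<^sub>S p) = boundS p - 1"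

definition uclosure :: "fm \<Rightarrow> fm" where
  "uclosure p = (AllN ^^ boundN p) ((AllS ^^ boundS p) p)"

section \<open>Provability\<close>

text \<open>Classical two-sorted natural deduction with equality. In the generalization rules the
  assumptions are lifted, so that index 0 plays the role of the eigenvariable.\<close>

inductive proves :: "fm set \<Rightarrow> fm \<Rightarrow> bool" (infix "\<turnstile>" 40) where
  Assm: "p \<in> \<Gamma> \<Longrightarrow> \<Gamma> \<turnstile> p"
| ImpI: "insert p \<Gamma> \<turnstile> q \<Longrightarrow> \<Gamma> \<turnstile> (p \<^bold>\<longrightarrow> q)"
| ImpE: "\<Gamma> \<turnstile> (p \<^bold>\<longrightarrow> q) \<Longrightarrow> \<Gamma> \<turnstile> p \<Longrightarrow> \<Gamma> \<turnstile> q"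
| RAA: "insert (\<^bold>\<not> p) \<Gamma> \<turnstile> \<^bold>\<bottom> \<Longrightarrow> \<Gamma> \<turnstile> p"
| AllNI: "liftN ` \<Gamma> \<turnstile> p \<Longrightarrow> \<Gamma> \<turnstile> (\<^bold>\<forall>\<^sub>N p)"
| AllNE: "\<Gamma> \<turnstile> (\<^bold>\<forall>\<^sub>N p) \<Longrightarrow> \<Gamma> \<turnstile> instN p t"
| AllSI: "liftS ` \<Gamma> \<turnstile> p \<Longrightarrow> \<Gamma> \<turnstile> (\<^bold>\<forall>\<^sub>S p)"
| AllSE: "\<Gamma> \<turnstile> (\<^bold>\<forall>\<^sub>S p) \<Longrightarrow> \<Gamma> \<turnstile> instS p X"
| Refl: "\<Gamma> \<turnstile> (t \<^bold>= t)"
| Leibniz: "\<Gamma> \<turnstile> (s \<^bold>= t) \<Longrightarrow> \<Gamma> \<turnstile> instN p s \<Longrightarrow> \<Gamma> \<turnstile> instN p t"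

section \<open>The system RCA0\<close>

text \<open>In a bounded quantifier the bounding term must not contain the bound variable,
  hence the lifted bound.\<close>

inductive bounded :: "fm \<Rightarrow> bool" where
  "bounded (s \<^bold>= t)"
| "bounded (s \<^bold>< t)"
| "bounded (t \<^bold>\<in> X)"
| "bounded \<^bold>\<bottom>"
| "bounded p \<Longrightarrow> bounded q \<Longrightarrow> bounded (p \<^bold>\<longrightarrow> q)"
| "bounded p \<Longrightarrow> bounded (\<^bold>\<forall>\<^sub>N (v 0 \<^bold>< lift_tm t \<^bold>\<longrightarrow> p))"

definition Sigma01 :: "fm set" where "Sigma01 = {\<^bold>\<exists>\<^sub>N p | p. bounded p}"
definition Pi01 :: "fm set" where "Pi01 = {\<^bold>\<forall>\<^sub>N p | p. bounded p}"

definition basic_axioms :: "fm set" where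
  "basic_axioms =
    {\<^bold>\<not> (Add (v 0) One \<^bold>= Zero),
     Add (v 0) One \<^bold>= Add (v 1) One \<^bold>\<longrightarrow> v 0 \<^bold>= v 1,
     Add (v 0) Zero \<^bold>= v 0,
     Add (v 0) (Add (v 1) One) \<^bold>= Add (Add (v 0) (v 1)) One,
     Mul (v 0) Zero \<^bold>= Zero,
     Mul (v 0) (Add (v 1) One) \<^bold>= Add (Mul (v 0) (v 1)) (v 0),
     \<^bold>\<not> (v 0 \<^bold>< Zero),
     v 0 \<^bold>< Add (v 1) One \<^bold>\<longleftrightarrow> v 0 \<^bold>< v 1 \<^bold>\<or> v 0 \<^bold>= v 1}"

text \<open>In both schemes index 0 of \<open>p\<close> (and \<open>q\<close>) is the distinguished number variable; all other
  free variables, of both sorts, are parameters. The lifting in \<open>comprehension\<close> keeps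
  the asserted set from occurring in \<open>p\<close>.\<close>

definition induction_ax :: "fm \<Rightarrow> fm" where
  "induction_ax p =
    (instN p Zero \<^bold>\<and>
     (\<^bold>\<forall>\<^sub>N (p \<^bold>\<longrightarrow> subst (case_nat (Add (v 0) One) (\<lambda>n. Var (Suc n))) id p))
     \<^bold>\<longrightarrow> (\<^bold>\<forall>\<^sub>N p))"

definition comprehension :: "fm \<Rightarrow> fm \<Rightarrow> fm" where
  "comprehension p q =
    ((\<^bold>\<forall>\<^sub>N (p \<^bold>\<longleftrightarrow> q)) \<^bold>\<longrightarrow> (\<^bold>\<exists>\<^sub>S (\<^bold>\<forall>\<^sub>N (v 0 \<^bold>\<in> 0 \<^bold>\<longleftrightarrow> liftS p))))"

definition RCA0 :: "fm set" where
  "RCA0 = uclosure ` (basic_axioms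
     \<union> {induction_ax p | p. p \<in> Sigma01}
     \<union> {comprehension p q | p q. p \<in> Sigma01 \<and> q \<in> Pi01})"

section \<open>The principles\<close>

text \<open>The usual pairing \<open>(i, j) = (i + j)\<^sup>2 + i\<close> codes binary relations, functions on pairs
  and sequences of sets as sets of numbers.\<close>

definition pair :: "tm \<Rightarrow> tm \<Rightarrow> tm" where
  "pair s t = Add (Mul (Add s t) (Add s t)) s"

text \<open>Below, the arguments \<open>A\<close>, \<open>C\<close>, \<open>D\<close>, \<open>F\<close>, \<open>H\<close>, \<open>R\<close>, \<open>T\<close> are indices of set variables.\<close>

definition Inf_set :: "nat \<Rightarrow> fm" where
  "Inf_set A = (\<^bold>\<forall>\<^sub>N \<^bold>\<exists>\<^sub>N (v 1 \<^bold>< v 0 \<^bold>\<and> v 0 \<^bold>\<in> A))"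

definition Subset :: "nat \<Rightarrow> nat \<Rightarrow> fm" where
  "Subset A B = (\<^bold>\<forall>\<^sub>N (v 0 \<^bold>\<in> A \<^bold>\<longrightarrow> v 0 \<^bold>\<in> B))"

definition Tournament :: "nat \<Rightarrow> nat \<Rightarrow> fm" where
  "Tournament D T =
    ((\<^bold>\<forall>\<^sub>N (v 0 \<^bold>\<in> T \<^bold>\<longrightarrow> (\<^bold>\<exists>\<^sub>N \<^bold>\<exists>\<^sub>N (v 1 \<^bold>\<in> D \<^bold>\<and> v 0 \<^bold>\<in> D \<^bold>\<and> v 2 \<^bold>= pair (v 1) (v 0))))) \<^bold>\<and>
     (\<^bold>\<forall>\<^sub>N (v 0 \<^bold>\<in> D \<^bold>\<longrightarrow> \<^bold>\<not> (pair (v 0) (v 0) \<^bold>\<in> T))) \<^bold>\<and>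
     (\<^bold>\<forall>\<^sub>N \<^bold>\<forall>\<^sub>N (v 1 \<^bold>\<in> D \<^bold>\<and> v 0 \<^bold>\<in> D \<^bold>\<and> \<^bold>\<not> (v 1 \<^bold>= v 0) \<^bold>\<longrightarrow>
        (pair (v 1) (v 0) \<^bold>\<in> T \<^bold>\<and> \<^bold>\<not> (pair (v 0) (v 1) \<^bold>\<in> T)) \<^bold>\<or>
        (\<^bold>\<not> (pair (v 1) (v 0) \<^bold>\<in> T) \<^bold>\<and> pair (v 0) (v 1) \<^bold>\<in> T))))"

definition Transitive_on :: "nat \<Rightarrow> nat \<Rightarrow> fm" where
  "Transitive_on H T =
    (\<^bold>\<forall>\<^sub>N \<^bold>\<forall>\<^sub>N \<^bold>\<forall>\<^sub>N (v 2 \<^bold>\<in> H \<^bold>\<and> v 1 \<^bold>\<in> H \<^bold>\<and> v 0 \<^bold>\<in> H \<^bold>\<and>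
       pair (v 2) (v 1) \<^bold>\<in> T \<^bold>\<and> pair (v 1) (v 0) \<^bold>\<in> T \<^bold>\<longrightarrow> pair (v 2) (v 0) \<^bold>\<in> T))"

definition EM :: fm where
  "EM = (\<^bold>\<forall>\<^sub>S \<^bold>\<forall>\<^sub>S (Inf_set 1 \<^bold>\<and> Tournament 1 0 \<^bold>\<longrightarrow>
     (\<^bold>\<exists>\<^sub>S (Subset 0 2 \<^bold>\<and> Inf_set 0 \<^bold>\<and> Transitive_on 0 1))))"

text \<open>A function on pairs \<open>x < s\<close> is coded by the set of all \<open>((x, s), y)\<close> with value \<open>y\<close>
  at \<open>(x, s)\<close>.\<close>

definition val :: "nat \<Rightarrow> tm \<Rightarrow> tm \<Rightarrow> tm \<Rightarrow> fm" where
  "val F x s y = (pair (pair x s) y \<^bold>\<in> F)"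

definition Colouring :: "nat \<Rightarrow> fm" where
  "Colouring F =
    ((\<^bold>\<forall>\<^sub>N (v 0 \<^bold>\<in> F \<^bold>\<longrightarrow>
        (\<^bold>\<exists>\<^sub>N \<^bold>\<exists>\<^sub>N \<^bold>\<exists>\<^sub>N (v 2 \<^bold>< v 1 \<^bold>\<and> v 3 \<^bold>= pair (pair (v 2) (v 1)) (v 0))))) \<^bold>\<and>
     (\<^bold>\<forall>\<^sub>N \<^bold>\<forall>\<^sub>N (v 1 \<^bold>< v 0 \<^bold>\<longrightarrow>
        (\<^bold>\<exists>\<^sub>N (val F (v 2) (v 1) (v 0) \<^bold>\<and> (\<^bold>\<forall>\<^sub>N (val F (v 3) (v 2) (v 0) \<^bold>\<longrightarrow> v 0 \<^bold>= v 1)))))))"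

definition Stable :: "nat \<Rightarrow> fm" where
  "Stable F = (\<^bold>\<forall>\<^sub>N \<^bold>\<exists>\<^sub>N \<^bold>\<exists>\<^sub>N \<^bold>\<forall>\<^sub>N (v 3 \<^bold>< v 0 \<^bold>\<and> v 1 \<^bold>< v 0 \<^bold>\<longrightarrow> val F (v 3) (v 0) (v 2)))"

definition Thin :: "nat \<Rightarrow> nat \<Rightarrow> fm" where
  "Thin F A = (\<^bold>\<exists>\<^sub>N \<^bold>\<not> (\<^bold>\<exists>\<^sub>N \<^bold>\<exists>\<^sub>N (v 1 \<^bold>\<in> A \<^bold>\<and> v 0 \<^bold>\<in> A \<^bold>\<and> v 1 \<^bold>< v 0 \<^bold>\<and> val F (v 1) (v 0) (v 2))))"

definition STS2 :: fm where
  "STS2 = (\<^bold>\<forall>\<^sub>S (Colouring 0 \<^bold>\<and> Stable 0 \<^bold>\<longrightarrow> (\<^bold>\<exists>\<^sub>S (Inf_set 0 \<^bold>\<and> Thin 1 0))))"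

text \<open>A sequence of sets is coded by a single set \<open>R\<close>, its \<open>i\<close>-th member
  being \<open>{x. (i, x) \<in> R}\<close>.\<close>

definition Cohesive :: "nat \<Rightarrow> nat \<Rightarrow> fm" where
  "Cohesive R C = (\<^bold>\<forall>\<^sub>N
     ((\<^bold>\<exists>\<^sub>N \<^bold>\<forall>\<^sub>N (v 0 \<^bold>\<in> C \<^bold>\<and> v 1 \<^bold>< v 0 \<^bold>\<longrightarrow> pair (v 2) (v 0) \<^bold>\<in> R)) \<^bold>\<or>
      (\<^bold>\<exists>\<^sub>N \<^bold>\<forall>\<^sub>N (v 0 \<^bold>\<in> C \<^bold>\<and> v 1 \<^bold>< v 0 \<^bold>\<longrightarrow> \<^bold>\<not> (pair (v 2) (v 0) \<^bold>\<in> R)))))"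

definition COH :: fm where
  "COH = (\<^bold>\<forall>\<^sub>S \<^bold>\<exists>\<^sub>S (Inf_set 0 \<^bold>\<and> Cohesive 1 0))"

section \<open>Structures, soundness, and the formulas in ordinary notation\<close>

text \<open>This section checks the encodings above: the calculus is sound for general (Henkin)
  structures, and the de Bruijn formulas say what they should in every structure.\<close>

record 'a L2_struct =
  zer :: 'a
  one :: 'a
  add :: "'a \<Rightarrow> 'a \<Rightarrow> 'a"
  mul :: "'a \<Rightarrow> 'a \<Rightarrow> 'a"
  les :: "'a \<Rightarrow> 'a \<Rightarrow> bool"
  Sets :: "'a set set"

primrec eval :: "'a L2_struct \<Rightarrow> (nat \<Rightarrow> 'a) \<Rightarrow> tm \<Rightarrow> 'a" where
  "eval M e (Var n) = e n"
| "eval M e Zero = zer M"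
| "eval M e One = one M"
| "eval M e (Add s t) = add M (eval M e s) (eval M e t)"
| "eval M e (Mul s t) = mul M (eval M e s) (eval M e t)"

primrec sat :: "'a L2_struct \<Rightarrow> (nat \<Rightarrow> 'a) \<Rightarrow> (nat \<Rightarrow> 'a set) \<Rightarrow> fm \<Rightarrow> bool" where
  "sat M e E (s \<^bold>= t) \<longleftrightarrow> eval M e s = eval M e t"
| "sat M e E (s \<^bold>< t) \<longleftrightarrow> les M (eval M e s) (eval M e t)"
| "sat M e E (t \<^bold>\<in> X) \<longleftrightarrow> eval M e t \<in> E X"
| "sat M e E \<^bold>\<bottom> \<longleftrightarrow> False"
| "sat M e E (p \<^bold>\<longrightarrow> q) \<longleftrightarrow> (sat M e E p \<longrightarrow> sat M e E q)"
| "sat M e E (\<^bold>\<forall>\<^sub>N p) \<longleftrightarrow> (\<forall>x. sat M (case_nat x e) E p)"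
| "sat M e E (\<^bold>\<forall>\<^sub>S p) \<longleftrightarrow> (\<forall>X\<in>Sets M. sat M e (case_nat X E) p)"

lemma eval_subst: "eval M e (subst_tm \<sigma> t) = eval M (\<lambda>n. eval M e (\<sigma> n)) t"
  by (induction t) auto

lemma sat_subst: "sat M e E (subst \<sigma> \<rho> p) \<longleftrightarrow> sat M (\<lambda>n. eval M e (\<sigma> n)) (\<lambda>n. E (\<rho> n)) p"
proof (induction p arbitrary: e E \<sigma> \<rho>)
  case (AllN p)
  have "(\<lambda>n. eval M (case_nat x e) (case_nat (Var 0) (\<lambda>n. lift_tm (\<sigma> n)) n))
      = case_nat x (\<lambda>n. eval M e (\<sigma> n))" for x
    by (rule ext) (simp add: lift_tm_def eval_subst split: nat.split)
  then show ?case by (simp add: AllN)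
next
  case (AllS p)
  have "(\<lambda>n. case_nat X E (case_nat 0 (\<lambda>n. Suc (\<rho> n)) n)) = case_nat X (\<lambda>n. E (\<rho> n))" for X
    by (rule ext) (simp split: nat.split)
  then show ?case by (simp add: AllS)
qed (simp_all add: eval_subst)

lemma sat_liftN: "sat M (case_nat x e) E (liftN p) \<longleftrightarrow> sat M e E p"
  by (simp add: liftN_def sat_subst)

lemma sat_liftS: "sat M e (case_nat X E) (liftS p) \<longleftrightarrow> sat M e E p"
  by (simp add: liftS_def sat_subst)

lemma sat_instN: "sat M e E (instN p t) \<longleftrightarrow> sat M (case_nat (eval M e t) e) E p"
proof -
  have "(\<lambda>n. eval M e (case_nat t Var n)) = case_nat (eval M e t) e"
    by (rule ext) (simp split: nat.split)
  then show ?thesis by (simp add: instN_def sat_subst)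
qed

lemma sat_instS: "sat M e E (instS p X) \<longleftrightarrow> sat M e (case_nat (E X) E) p"
proof -
  have "(\<lambda>n. E (case_nat X id n)) = case_nat (E X) E"
    by (rule ext) (simp split: nat.split)
  then show ?thesis by (simp add: instS_def sat_subst)
qed

theorem soundness:
  assumes "\<Gamma> \<turnstile> p" and "\<forall>q\<in>\<Gamma>. sat M e E q" and "range E \<subseteq> Sets M"
  shows "sat M e E p"
  using assms
proof (induction arbitrary: e E rule: proves.induct)
  case (AllNI \<Gamma> p)
  then show ?case by (simp add: sat_liftN)
next
  case (AllSI \<Gamma> p)
  have "sat M e (case_nat X E) p" if "X \<in> Sets M" for X
    using AllSI.prems that by (intro AllSI.IH) (auto simp: sat_liftS image_subset_iff split: nat.split)
  then show ?case by simp
next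
  case (AllSE \<Gamma> p X)
  have "E X \<in> Sets M"
    using AllSE.prems(2) by blast
  then show ?case using AllSE.IH AllSE.prems by (simp add: sat_instS)
qed (auto simp: sat_instN)

definition pr :: "'a L2_struct \<Rightarrow> 'a \<Rightarrow> 'a \<Rightarrow> 'a" where
  "pr M x y = add M (mul M (add M x y) (add M x y)) x"

lemma eval_pair [simp]: "eval M e (pair s t) = pr M (eval M e s) (eval M e t)"
  by (simp add: pair_def pr_def)

lemmas reading_simps = sat.simps eval_pair eval.simps numeral_2_eq_2 numeral_3_eq_3 One_nat_def
  nat.case subset_iff mem_Collect_eq Ball_def Bex_def Ex1_def simp_thms not_all not_imp de_Morgan_conj

lemma sat_Inf_set: "sat M e E (Inf_set A) \<longleftrightarrow> (\<forall>x. \<exists>y\<in>E A. les M x y)"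
  by (simp only: Inf_set_def reading_simps) blast

lemma sat_Subset: "sat M e E (Subset A B) \<longleftrightarrow> E A \<subseteq> E B"
  by (simp only: Subset_def reading_simps)

lemma sat_Tournament:
  "sat M e E (Tournament D T) \<longleftrightarrow>
    E T \<subseteq> {pr M x y | x y. x \<in> E D \<and> y \<in> E D} \<and>
    (\<forall>x\<in>E D. pr M x x \<notin> E T) \<and>
    (\<forall>x\<in>E D. \<forall>y\<in>E D. x \<noteq> y \<longrightarrow>
      pr M x y \<in> E T \<and> pr M y x \<notin> E T \<or> pr M x y \<notin> E T \<and> pr M y x \<in> E T)"
  by (simp only: Tournament_def reading_simps) blast

lemma sat_Transitive_on:
  "sat M e E (Transitive_on H T) \<longleftrightarrow>
    (\<forall>x\<in>E H. \<forall>y\<in>E H. \<forall>z\<in>E H.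
      pr M x y \<in> E T \<and> pr M y z \<in> E T \<longrightarrow> pr M x z \<in> E T)"
  by (simp only: Transitive_on_def reading_simps) blast

lemma sat_Colouring:
  "sat M e E (Colouring F) \<longleftrightarrow>
    E F \<subseteq> {pr M (pr M x s) y | x s y. les M x s} \<and>
    (\<forall>x s. les M x s \<longrightarrow> (\<exists>!y. pr M (pr M x s) y \<in> E F))"
  by (simp only: Colouring_def val_def reading_simps) blast

lemma sat_Stable:
  "sat M e E (Stable F) \<longleftrightarrow>
    (\<forall>x. \<exists>y b. \<forall>s. les M x s \<and> les M b s \<longrightarrow> pr M (pr M x s) y \<in> E F)"
  by (simp only: Stable_def val_def reading_simps) blast

lemma sat_Thin:
  "sat M e E (Thin F A) \<longleftrightarrow>
    (\<exists>c. \<not> (\<exists>x\<in>E A. \<exists>s\<in>E A. les M x s \<and> pr M (pr M x s) c \<in> E F))"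
  by (simp only: Thin_def val_def reading_simps) blast

lemma sat_Cohesive:
  "sat M e E (Cohesive R C) \<longleftrightarrow>
    (\<forall>i. (\<exists>b. \<forall>x\<in>E C. les M b x \<longrightarrow> pr M i x \<in> E R) \<or>
         (\<exists>b. \<forall>x\<in>E C. les M b x \<longrightarrow> pr M i x \<notin> E R))"
  by (simp only: Cohesive_def reading_simps) blast

end

theory Submission
  imports Defs "HOL-Library.Countable_Set"
begin

text \<open>By completeness of the calculus it suffices to argue in an arbitrary model of RCA0. Let \<open>f\<close> be
  stable without infinite thin set, and let \<open>R\<close> be a sequence of sets. Let \<open>S\<close> be the sequence with
  \<open>S\<^sub>2\<^sub>i = R\<^sub>i\<close> and \<open>S\<^sub>2\<^sub>i\<^sub>+\<^sub>1\<close> the complement of \<open>R\<^sub>i\<close>, and orient each pair \<open>x < s\<close> as \<open>x \<rightarrow> s\<close> iff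
  \<open>s\<close> is in the set of \<open>S\<close> with index \<open>f(x, s)\<close>. Let \<open>H\<close> be an infinite transitive subtournament.

  If every colour is the limit colour of some element of \<open>H\<close>, choose \<open>x\<close> and \<open>y\<close> in \<open>H\<close> with limit
  colours \<open>2i\<close> and \<open>2i + 1\<close>. If \<open>x \<rightarrow> y\<close>, then by transitivity \<open>y \<rightarrow> s\<close> implies \<open>x \<rightarrow> s\<close>, so
  almost every \<open>s\<close> in \<open>H\<close> that lies in the complement of \<open>R\<^sub>i\<close> lies in \<open>R\<^sub>i\<close>; hence almost all of \<open>H\<close>
  lies in \<open>R\<^sub>i\<close>. If \<open>y \<rightarrow> x\<close>, almost all of \<open>H\<close> lies in the complement. So \<open>H\<close> is cohesive.

  If the colour \<open>c\<close> is not a limit colour on \<open>H\<close>, orient the pairs \<open>x < s\<close> of \<open>H\<close> as \<open>x \<rightarrow> s\<close> iff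
  \<open>f(x, s) \<noteq> c\<close>. In an infinite transitive subtournament \<open>K\<close>, the elements \<open>s\<close> with \<open>x \<rightarrow> s\<close> for all
  smaller \<open>x\<close> in \<open>K\<close> form a set that omits the colour \<open>c\<close>. This set is defined by a bounded formula, so
  it exists without coding finite sequences, and showing it infinite needs no bounding
  principle beyond \<open>\<Sigma>\<^sub>1\<close> induction.\<close>

section \<open>Substitution\<close>

abbreviation up :: "(nat \<Rightarrow> tm) \<Rightarrow> nat \<Rightarrow> tm" where
  "up \<sigma> \<equiv> case_nat (Var 0) (\<lambda>n. lift_tm (\<sigma> n))"

abbreviation upS :: "(nat \<Rightarrow> nat) \<Rightarrow> nat \<Rightarrow> nat" where
  "upS \<rho> \<equiv> case_nat 0 (\<lambda>n. Suc (\<rho> n))"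

lemma subst_tm_subst_tm:
  "subst_tm \<sigma>' (subst_tm \<sigma> t) = subst_tm (\<lambda>n. subst_tm \<sigma>' (\<sigma> n)) t"
  by (induction t) auto

lemma subst_tm_Var [simp]: "subst_tm Var t = t"
  by (induction t) auto

lemma subst_tm_cong: "(\<And>n. n < bound_tm t \<Longrightarrow> \<sigma> n = \<sigma>' n) \<Longrightarrow> subst_tm \<sigma> t = subst_tm \<sigma>' t"
  by (induction t) auto

lemma subst_tm_up_lift_tm: "subst_tm (up \<sigma>) (lift_tm t) = lift_tm (subst_tm \<sigma> t)"
  by (simp add: lift_tm_def subst_tm_subst_tm)

text \<open>Needed for fresh indices: a renaming that differs from lifting only at an index above
  the bounds acts as lifting.\<close>

lemma subst_cong:
  assumes "\<And>n. n < boundN p \<Longrightarrow> \<sigma> n = \<sigma>' n" and "\<And>n. n < boundS p \<Longrightarrow> \<rho> n = \<rho>' n"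
  shows "subst \<sigma> \<rho> p = subst \<sigma>' \<rho>' p"
  using assms
proof (induction p arbitrary: \<sigma> \<sigma>' \<rho> \<rho>')
  case (AllN p)
  have "subst (up \<sigma>) \<rho> p = subst (up \<sigma>') \<rho>' p"
    using AllN.prems by (intro AllN.IH) (auto split: nat.split)
  then show ?case by simp
next
  case (AllS p)
  have "subst \<sigma> (upS \<rho>) p = subst \<sigma>' (upS \<rho>') p"
    using AllS.prems by (intro AllS.IH) (auto split: nat.split)
  then show ?case by simp
next
  case (Imp p q)
  show ?case
    using Imp.prems by (auto intro!: Imp.IH)
qed (auto intro!: subst_tm_cong)

lemma subst_subst:
  "subst \<sigma>' \<rho>' (subst \<sigma> \<rho> p) = subst (\<lambda>n. subst_tm \<sigma>' (\<sigma> n)) (\<lambda>n. \<rho>' (\<rho> n)) p"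
proof (induction p arbitrary: \<sigma> \<rho> \<sigma>' \<rho>')
  case (AllN p)
  have "(\<lambda>n. subst_tm (up \<sigma>') (up \<sigma> n)) = up (\<lambda>n. subst_tm \<sigma>' (\<sigma> n))"
    by (rule ext) (simp add: subst_tm_up_lift_tm split: nat.split)
  then show ?case by (simp add: AllN)
next
  case (AllS p)
  have "(\<lambda>n. upS \<rho>' (upS \<rho> n)) = upS (\<lambda>n. \<rho>' (\<rho> n))"
    by (rule ext) (simp split: nat.split)
  then show ?case by (simp add: AllS)
qed (simp_all add: subst_tm_subst_tm)

lemma subst_Var_id [simp]: "subst Var id p = p"
proof (induction p)
  case (AllN p)
  have "up Var = Var"
    by (rule ext) (simp add: lift_tm_def split: nat.split)
  then show ?case using AllN by (simp only: subst.simps)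
next
  case (AllS p)
  have "upS id = id"
    by (rule ext) (simp split: nat.split)
  then show ?case using AllS by (simp only: subst.simps)
qed simp_all

lemma subst_liftN: "subst (up \<sigma>) \<rho> (liftN p) = liftN (subst \<sigma> \<rho> p)"
  by (simp add: liftN_def subst_subst lift_tm_def)

lemma subst_liftS: "subst \<sigma> (upS \<rho>) (liftS p) = liftS (subst \<sigma> \<rho> p)"
  by (simp add: liftS_def subst_subst)

text \<open>Substituting under a binder and then instantiating it is a single substitution; the
  truth lemma for the term model meets quantifiers in this form.\<close>

lemma instN_subst_up: "instN (subst (up \<sigma>) \<rho> p) t = subst (case_nat t \<sigma>) \<rho> p"
proof -
  have "(\<lambda>n. subst_tm (case_nat t Var) (up \<sigma> n)) = case_nat t \<sigma>"
    by (rule ext) (simp add: lift_tm_def subst_tm_subst_tm split: nat.split)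
  then show ?thesis by (simp add: instN_def subst_subst)
qed

lemma instS_subst_up: "instS (subst \<sigma> (upS \<rho>) p) X = subst \<sigma> (case_nat X \<rho>) p"
proof -
  have "(\<lambda>n. case_nat X id (upS \<rho> n)) = case_nat X \<rho>"
    by (rule ext) (simp split: nat.split)
  then show ?thesis by (simp add: instS_def subst_subst)
qed

lemma subst_instN: "subst \<sigma> \<rho> (instN p t) = instN (subst (up \<sigma>) \<rho> p) (subst_tm \<sigma> t)"
proof -
  have "(\<lambda>n. subst_tm \<sigma> (case_nat t Var n)) = case_nat (subst_tm \<sigma> t) \<sigma>"
    by (rule ext) (simp split: nat.split)
  then show ?thesis by (simp add: instN_subst_up) (simp add: instN_def subst_subst)
qed

lemma subst_instS: "subst \<sigma> \<rho> (instS p X) = instS (subst \<sigma> (upS \<rho>) p) (\<rho> X)"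
proof -
  have "(\<lambda>n. \<rho> (case_nat X id n)) = case_nat (\<rho> X) \<rho>"
    by (rule ext) (simp split: nat.split)
  then show ?thesis by (simp add: instS_subst_up) (simp add: instS_def subst_subst)
qed

section \<open>Structural properties of provability\<close>

lemma proves_mono: "\<Gamma> \<turnstile> p \<Longrightarrow> \<Gamma> \<subseteq> \<Gamma>' \<Longrightarrow> \<Gamma>' \<turnstile> p"
proof (induction arbitrary: \<Gamma>' rule: proves.induct)
  case (ImpI p \<Gamma> q)
  then show ?case by (meson insert_mono proves.ImpI)
next
  case (RAA p \<Gamma>)
  then show ?case by (meson insert_mono proves.RAA)
next
  case (AllNI \<Gamma> p)
  then show ?case by (meson image_mono proves.AllNI)
next
  case (AllSI \<Gamma> p)
  then show ?case by (meson image_mono proves.AllSI)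
next
  case (ImpE \<Gamma> p q)
  then show ?case by (meson proves.ImpE)
next
  case (Leibniz \<Gamma> s t p)
  then show ?case by (meson proves.Leibniz)
qed (auto intro: proves.Assm proves.Refl proves.AllNE proves.AllSE)

text \<open>Needed to rename eigenvariables. For the generalization rules the induction hypothesis
  is used at the substitution extended under the binder, which commutes with lifting the
  assumptions.\<close>

lemma proves_subst: "\<Gamma> \<turnstile> p \<Longrightarrow> subst \<sigma> \<rho> ` \<Gamma> \<turnstile> subst \<sigma> \<rho> p"
proof (induction arbitrary: \<sigma> \<rho> rule: proves.induct)
  case (ImpI p \<Gamma> q)
  then show ?case by (auto intro: proves.ImpI)
next
  case (ImpE \<Gamma> p q)
  have "subst \<sigma> \<rho> ` \<Gamma> \<turnstile> (subst \<sigma> \<rho> p \<^bold>\<longrightarrow> subst \<sigma> \<rho> q)"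
    using ImpE.IH(1)[of \<sigma> \<rho>] by simp
  then show ?case by (rule proves.ImpE) (rule ImpE.IH)
next
  case (RAA p \<Gamma>)
  have "insert (\<^bold>\<not> subst \<sigma> \<rho> p) (subst \<sigma> \<rho> ` \<Gamma>) \<turnstile> \<^bold>\<bottom>"
    using RAA.IH[of \<sigma> \<rho>] by simp
  then show ?case by (rule proves.RAA)
next
  case (AllNI \<Gamma> p)
  have "liftN ` subst \<sigma> \<rho> ` \<Gamma> \<turnstile> subst (up \<sigma>) \<rho> p"
    using AllNI.IH[of "up \<sigma>" \<rho>] by (simp add: image_image subst_liftN)
  then show ?case by (simp add: proves.AllNI)
next
  case (AllNE \<Gamma> p t)
  then show ?case by (simp add: subst_instN proves.AllNE)
next
  case (AllSI \<Gamma> p)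
  have "liftS ` subst \<sigma> \<rho> ` \<Gamma> \<turnstile> subst \<sigma> (upS \<rho>) p"
    using AllSI.IH[of \<sigma> "upS \<rho>"] by (simp add: image_image subst_liftS)
  then show ?case by (simp add: proves.AllSI)
next
  case (AllSE \<Gamma> p X)
  then show ?case by (simp add: subst_instS proves.AllSE)
next
  case (Leibniz \<Gamma> s t p)
  have "subst \<sigma> \<rho> ` \<Gamma> \<turnstile> instN (subst (up \<sigma>) \<rho> p) (subst_tm \<sigma> t)"
    using Leibniz.IH(1)[of \<sigma> \<rho>] Leibniz.IH(2)[of \<sigma> \<rho>]
    by (simp add: subst_instN) (rule proves.Leibniz)
  then show ?case by (simp add: subst_instN)
qed (auto intro: proves.Assm proves.Refl)

text \<open>Derivations are finite. In the generalization rules a finite set of lifted assumptions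
  is the image of a finite set of assumptions.\<close>

lemma proves_compact: "\<Gamma> \<turnstile> p \<Longrightarrow> \<exists>G. finite G \<and> G \<subseteq> \<Gamma> \<and> G \<turnstile> p"
proof (induction rule: proves.induct)
  case (Assm p \<Gamma>)
  have "{p} \<turnstile> p" by (simp add: proves.Assm)
  with Assm show ?case by (intro exI[of _ "{p}"]) simp
next
  case (ImpI p \<Gamma> q)
  then obtain G where G: "finite G" "G \<subseteq> insert p \<Gamma>" "G \<turnstile> q" by blast
  have "insert p (G - {p}) \<turnstile> q" using G(3) by (rule proves_mono) blast
  then have "G - {p} \<turnstile> (p \<^bold>\<longrightarrow> q)" by (rule proves.ImpI)
  with G show ?case by (intro exI[of _ "G - {p}"]) blast
next
  case (ImpE \<Gamma> p q)
  then obtain G G' where G: "finite G" "G \<subseteq> \<Gamma>" "G \<turnstile> (p \<^bold>\<longrightarrow> q)"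
    and G': "finite G'" "G' \<subseteq> \<Gamma>" "G' \<turnstile> p" by blast
  have "G \<union> G' \<turnstile> q"
    by (rule proves.ImpE[OF proves_mono[OF G(3)] proves_mono[OF G'(3)]]) simp_all
  with G G' show ?case by (intro exI[of _ "G \<union> G'"]) simp
next
  case (RAA p \<Gamma>)
  then obtain G where G: "finite G" "G \<subseteq> insert (\<^bold>\<not> p) \<Gamma>" "G \<turnstile> \<^bold>\<bottom>" by blast
  have "insert (\<^bold>\<not> p) (G - {\<^bold>\<not> p}) \<turnstile> \<^bold>\<bottom>" using G(3) by (rule proves_mono) blast
  then have "G - {\<^bold>\<not> p} \<turnstile> p" by (rule proves.RAA)
  with G show ?case by (intro exI[of _ "G - {\<^bold>\<not> p}"]) blast
next
  case (AllNI \<Gamma> p)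
  then obtain G where G: "finite G" "G \<subseteq> liftN ` \<Gamma>" "G \<turnstile> p" by blast
  obtain G' where G': "G' \<subseteq> \<Gamma>" "finite G'" "G = liftN ` G'"
    using finite_subset_image[OF G(1,2)] by blast
  have "G' \<turnstile> \<^bold>\<forall>\<^sub>N p" using G(3) G'(3) by (simp add: proves.AllNI)
  with G' show ?case by (intro exI[of _ G']) simp
next
  case (AllNE \<Gamma> p t)
  then obtain G where G: "finite G" "G \<subseteq> \<Gamma>" "G \<turnstile> \<^bold>\<forall>\<^sub>N p" by blast
  from G(3) have "G \<turnstile> instN p t" by (rule proves.AllNE)
  with G show ?case by (intro exI[of _ G]) simp
next
  case (AllSI \<Gamma> p)
  then obtain G where G: "finite G" "G \<subseteq> liftS ` \<Gamma>" "G \<turnstile> p" by blast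
  obtain G' where G': "G' \<subseteq> \<Gamma>" "finite G'" "G = liftS ` G'"
    using finite_subset_image[OF G(1,2)] by blast
  have "G' \<turnstile> \<^bold>\<forall>\<^sub>S p" using G(3) G'(3) by (simp add: proves.AllSI)
  with G' show ?case by (intro exI[of _ G']) simp
next
  case (AllSE \<Gamma> p X)
  then obtain G where G: "finite G" "G \<subseteq> \<Gamma>" "G \<turnstile> \<^bold>\<forall>\<^sub>S p" by blast
  from G(3) have "G \<turnstile> instS p X" by (rule proves.AllSE)
  with G show ?case by (intro exI[of _ G]) simp
next
  case (Refl \<Gamma> t)
  show ?case by (intro exI[of _ "{}"]) (simp add: proves.Refl)
next
  case (Leibniz \<Gamma> s t p)
  then obtain G G' where G: "finite G" "G \<subseteq> \<Gamma>" "G \<turnstile> (s \<^bold>= t)"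
    and G': "finite G'" "G' \<subseteq> \<Gamma>" "G' \<turnstile> instN p s" by blast
  have "G \<union> G' \<turnstile> instN p t"
    by (rule proves.Leibniz[OF proves_mono[OF G(3)] proves_mono[OF G'(3)]]) simp_all
  with G G' show ?case by (intro exI[of _ "G \<union> G'"]) simp
qed

section \<open>Completeness\<close>

text \<open>One bound serves the whole set and both sorts, so that every index from \<open>k\<close>
  on is fresh for all of \<open>\<Gamma>\<close> and can act as an eigenvariable.\<close>

definition bounded_vars :: "nat \<Rightarrow> fm set \<Rightarrow> bool" where
  "bounded_vars k \<Gamma> \<longleftrightarrow> (\<forall>p\<in>\<Gamma>. boundN p \<le> k \<and> boundS p \<le> k)"

lemma bounded_vars_insert:
  "\<exists>k. bounded_vars k \<Gamma> \<Longrightarrow> \<exists>k. bounded_vars k (insert p \<Gamma>)"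
proof -
  assume "\<exists>k. bounded_vars k \<Gamma>"
  then obtain k where "bounded_vars k \<Gamma>" ..
  then have "bounded_vars (max k (max (boundN p) (boundS p))) (insert p \<Gamma>)"
    by (auto simp: bounded_vars_def)
  then show ?thesis ..
qed

text \<open>Renaming \<open>k\<close> to 0 and shifting all other indices up turns
  \<open>\<Gamma>\<close> into its lifting, since \<open>k\<close> does not occur there, and turns
  the instance back into \<open>q\<close>. This recovers the usual eigenvariable rule.\<close>

lemma AllNI_fresh:
  assumes \<Gamma>: "\<Gamma> \<turnstile> instN q (Var k)" and k: "bounded_vars k (insert (\<^bold>\<forall>\<^sub>N q) \<Gamma>)"
  shows "\<Gamma> \<turnstile> (\<^bold>\<forall>\<^sub>N q)"
proof (rule AllNI)
  define \<sigma> where "\<sigma> n = (if n = k then Var 0 else Var (Suc n))" for n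
  have "subst \<sigma> id r = liftN r" if "r \<in> \<Gamma>" for r
    using k that by (auto simp: liftN_def bounded_vars_def \<sigma>_def intro!: subst_cong)
  then have "subst \<sigma> id ` \<Gamma> = liftN ` \<Gamma>" by simp
  moreover have "subst \<sigma> id (instN q (Var k)) = q"
  proof -
    have "subst \<sigma> id (instN q (Var k)) = subst Var id q"
      using k unfolding instN_def subst_subst
      by (intro subst_cong) (auto simp: bounded_vars_def \<sigma>_def split: nat.split)
    then show ?thesis by simp
  qed
  ultimately show "liftN ` \<Gamma> \<turnstile> q"
    using proves_subst[OF \<Gamma>, of \<sigma> id] by simp
qed

lemma AllSI_fresh:
  assumes \<Gamma>: "\<Gamma> \<turnstile> instS q k" and k: "bounded_vars k (insert (\<^bold>\<forall>\<^sub>S q) \<Gamma>)"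
  shows "\<Gamma> \<turnstile> (\<^bold>\<forall>\<^sub>S q)"
proof (rule AllSI)
  define \<rho> where "\<rho> n = (if n = k then 0 else Suc n)" for n
  have "subst Var \<rho> r = liftS r" if "r \<in> \<Gamma>" for r
    using k that by (auto simp: liftS_def bounded_vars_def \<rho>_def intro!: subst_cong)
  then have "subst Var \<rho> ` \<Gamma> = liftS ` \<Gamma>" by simp
  moreover have "subst Var \<rho> (instS q k) = q"
  proof -
    have "subst Var \<rho> (instS q k) = subst Var id q"
      using k unfolding instS_def subst_subst
      by (intro subst_cong) (auto simp: bounded_vars_def \<rho>_def split: nat.split)
    then show ?thesis by simp
  qed
  ultimately show "liftS ` \<Gamma> \<turnstile> q"
    using proves_subst[OF \<Gamma>, of Var \<rho>] by simp
qed

section \<open>Extending a consistent set to a complete one with witnesses\<close>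

definition consistent :: "fm set \<Rightarrow> bool" where
  "consistent \<Gamma> \<longleftrightarrow> \<not> (\<Gamma> \<turnstile> \<^bold>\<bottom>)"

text \<open>Henkin's condition is built in: a universal formula counts as refuted only if a negated
  instance is present as well.\<close>

definition decides :: "fm set \<Rightarrow> fm \<Rightarrow> bool" where
  "decides \<Gamma> p \<longleftrightarrow> p \<in> \<Gamma> \<or> \<^bold>\<not> p \<in> \<Gamma> \<and>
     (\<forall>q. p = \<^bold>\<forall>\<^sub>N q \<longrightarrow> (\<exists>t. \<^bold>\<not> instN q t \<in> \<Gamma>)) \<and>
     (\<forall>q. p = \<^bold>\<forall>\<^sub>S q \<longrightarrow> (\<exists>X. \<^bold>\<not> instS q X \<in> \<Gamma>))"

lemma decides_mono: "decides \<Gamma> p \<Longrightarrow> \<Gamma> \<subseteq> \<Gamma>' \<Longrightarrow> decides \<Gamma>' p"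
  by (auto simp: decides_def) (meson subsetD)+

text \<open>If \<open>p\<close> cannot be added, its negation can. For a universal \<open>p\<close>
  the witness is a fresh variable \<open>k\<close>: if the instance at \<open>k\<close> were
  provable, generalization would prove \<open>p\<close>.\<close>

lemma consistent_decide:
  assumes "consistent \<Gamma>" and bd: "\<exists>k. bounded_vars k \<Gamma>"
  shows "\<exists>\<Gamma>'. \<Gamma> \<subseteq> \<Gamma>' \<and> consistent \<Gamma>' \<and> (\<exists>k. bounded_vars k \<Gamma>') \<and> decides \<Gamma>' p"
proof (cases "consistent (insert p \<Gamma>)")
  case True
  then show ?thesis
    using bounded_vars_insert[OF bd] by (intro exI[of _ "insert p \<Gamma>"]) (auto simp: decides_def)
next
  case False
  let ?\<Delta> = "insert (\<^bold>\<not> p) \<Gamma>"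
  have "\<Gamma> \<turnstile> \<^bold>\<not> p"
    using False by (intro ImpI) (simp add: consistent_def)
  have notp: "\<not> (?\<Delta> \<turnstile> p)"
  proof (rule notI)
    assume "?\<Delta> \<turnstile> p"
    moreover have "?\<Delta> \<turnstile> \<^bold>\<not> p" by (simp add: Assm)
    ultimately have "?\<Delta> \<turnstile> \<^bold>\<bottom>" using ImpE by blast
    then have "\<Gamma> \<turnstile> p" by (rule RAA)
    with \<open>\<Gamma> \<turnstile> \<^bold>\<not> p\<close> have "\<Gamma> \<turnstile> \<^bold>\<bottom>" by (rule ImpE)
    with assms(1) show False by (simp add: consistent_def)
  qed
  then have cons: "consistent ?\<Delta>"
    unfolding consistent_def using RAA[of p ?\<Delta>] by auto
  have bd\<Delta>: "\<exists>k. bounded_vars k ?\<Delta>" by (rule bounded_vars_insert[OF bd])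
  obtain k where k: "bounded_vars k (insert p ?\<Delta>)"
    using bounded_vars_insert[OF bd\<Delta>] by blast
  consider q where "p = \<^bold>\<forall>\<^sub>N q" | q where "p = \<^bold>\<forall>\<^sub>S q"
    | "\<forall>q. p \<noteq> \<^bold>\<forall>\<^sub>N q" "\<forall>q. p \<noteq> \<^bold>\<forall>\<^sub>S q" by blast
  then show ?thesis
  proof cases
    case (1 q)
    let ?w = "\<^bold>\<not> instN q (Var k)"
    have "\<not> (?\<Delta> \<turnstile> instN q (Var k))"
      using notp AllNI_fresh k unfolding 1 by blast
    then have "consistent (insert ?w ?\<Delta>)"
      using RAA by (auto simp only: consistent_def)
    then show ?thesis
      using bounded_vars_insert[OF bd\<Delta>] 1
      by (intro exI[of _ "insert ?w ?\<Delta>"]) (auto simp: decides_def)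
  next
    case (2 q)
    let ?w = "\<^bold>\<not> instS q k"
    have "\<not> (?\<Delta> \<turnstile> instS q k)"
      using notp AllSI_fresh k unfolding 2 by blast
    then have "consistent (insert ?w ?\<Delta>)"
      using RAA by (auto simp only: consistent_def)
    then show ?thesis
      using bounded_vars_insert[OF bd\<Delta>] 2
      by (intro exI[of _ "insert ?w ?\<Delta>"]) (auto simp: decides_def)
  next
    case 3
    then show ?thesis
      using cons bd\<Delta> by (intro exI[of _ ?\<Delta>]) (auto simp: decides_def)
  qed
qed

instance tm :: countable by countable_datatype
instance fm :: countable by countable_datatype

text \<open>Formulas are decided one after another along an enumeration. Each stage adds only a few
  formulas, so fresh indices remain; consistency of the union follows from compactness.\<close>

lemma henkin_extension:
  assumes "consistent \<Gamma>" and "\<exists>k. bounded_vars k \<Gamma>"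
  obtains \<Delta> where "\<Gamma> \<subseteq> \<Delta>" "consistent \<Delta>" "\<And>p. decides \<Delta> p"
proof -
  define ext where "ext S p = (SOME S'. S \<subseteq> S' \<and> consistent S' \<and> (\<exists>k. bounded_vars k S') \<and> decides S' p)"
    for S p
  have ext: "S \<subseteq> ext S p \<and> consistent (ext S p) \<and> (\<exists>k. bounded_vars k (ext S p)) \<and> decides (ext S p) p"
    if "consistent S" "\<exists>k. bounded_vars k S" for S p
    unfolding ext_def by (rule someI_ex) (rule consistent_decide[OF that])
  define S where "S = rec_nat \<Gamma> (\<lambda>n S. ext S (from_nat n))"
  have S0: "S 0 = \<Gamma>" and SSuc: "S (Suc n) = ext (S n) (from_nat n)" for n
    by (simp_all add: S_def)
  have inv: "consistent (S n) \<and> (\<exists>k. bounded_vars k (S n))" for n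
  proof (induction n)
    case 0
    then show ?case using assms by (simp only: S0)
  next
    case (Suc n)
    then show ?case using ext by (simp only: SSuc)
  qed
  have step: "S n \<subseteq> S (Suc n)" "decides (S (Suc n)) (from_nat n)" for n
    using ext inv[of n] by (simp_all only: SSuc)
  have mono: "m \<le> n \<Longrightarrow> S m \<subseteq> S n" for m n
    by (rule lift_Suc_mono_le) (rule step(1))
  show ?thesis
  proof
    show "\<Gamma> \<subseteq> (\<Union>n. S n)" using S0 by blast
    show "consistent (\<Union>n. S n)"
      unfolding consistent_def
    proof
      assume "(\<Union>n. S n) \<turnstile> \<^bold>\<bottom>"
      then obtain G where G: "finite G" "G \<subseteq> (\<Union>n. S n)" "G \<turnstile> \<^bold>\<bottom>"
        using proves_compact by blast
      have "\<exists>n. G \<subseteq> S n"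
        using G(1,2)
      proof (induction rule: finite_induct)
        case (insert x F)
        then obtain m n where "F \<subseteq> S m" "x \<in> S n" by auto
        then have "insert x F \<subseteq> S (max m n)"
          using mono[of m "max m n"] mono[of n "max m n"] by auto
        then show ?case ..
      qed simp
      then show False using G(3) inv by (meson consistent_def proves_mono)
    qed
    show "decides (\<Union>n. S n) p" for p
      \<comment> \<open>The formula \<open>p\<close> is treated at stage \<open>to_nat p\<close>,
        and the decision persists in the union.\<close>
      using decides_mono[OF step(2)[of "to_nat p"], of "\<Union>n. S n"] by (simp add: UN_upper)
  qed
qed

section \<open>The term model of a complete theory with witnesses\<close>

lemma subst_tm_lift_tm [simp]: "subst_tm (case_nat t Var) (lift_tm s) = s"
  by (simp add: lift_tm_def subst_tm_subst_tm)

locale henkin_theory =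
  fixes \<Delta> :: "fm set"
  assumes consistent: "consistent \<Delta>" and decides: "decides \<Delta> p"
begin

lemma proves_iff: "\<Delta> \<turnstile> p \<longleftrightarrow> p \<in> \<Delta>"
proof
  assume "\<Delta> \<turnstile> p"
  then have "\<^bold>\<not> p \<notin> \<Delta>"
    using consistent ImpE[of \<Delta> p "\<^bold>\<bottom>"] by (auto simp: consistent_def intro: Assm)
  then show "p \<in> \<Delta>" using decides[of p] by (auto simp: decides_def)
qed (rule Assm)

lemma falsum: "\<^bold>\<bottom> \<notin> \<Delta>"
  using consistent proves_iff by (simp add: consistent_def)

lemma imp_iff: "(p \<^bold>\<longrightarrow> q) \<in> \<Delta> \<longleftrightarrow> (p \<in> \<Delta> \<longrightarrow> q \<in> \<Delta>)"
proof
  show "(p \<^bold>\<longrightarrow> q) \<in> \<Delta> \<Longrightarrow> p \<in> \<Delta> \<longrightarrow> q \<in> \<Delta>"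
    using ImpE[of \<Delta> p q] by (simp add: proves_iff)
next
  assume pq: "p \<in> \<Delta> \<longrightarrow> q \<in> \<Delta>"
  show "(p \<^bold>\<longrightarrow> q) \<in> \<Delta>"
  proof (cases "p \<in> \<Delta>")
    case True
    with pq have "\<Delta> \<turnstile> q" by (simp add: proves_iff)
    then have "insert p \<Delta> \<turnstile> q" by (rule proves_mono) blast
    then show ?thesis using ImpI proves_iff by blast
  next
    case False
    then have "\<^bold>\<not> p \<in> \<Delta>" using decides[of p] by (auto simp: decides_def)
    then have "insert p \<Delta> \<turnstile> \<^bold>\<not> p" by (intro Assm) simp
    moreover have "insert p \<Delta> \<turnstile> p" by (rule Assm) simp
    ultimately have "insert p \<Delta> \<turnstile> \<^bold>\<bottom>" by (rule ImpE)
    then have "insert (\<^bold>\<not> q) (insert p \<Delta>) \<turnstile> \<^bold>\<bottom>" by (rule proves_mono) blast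
    then have "insert p \<Delta> \<turnstile> q" by (rule RAA)
    then show ?thesis using ImpI proves_iff by blast
  qed
qed

lemma allN_iff: "\<^bold>\<forall>\<^sub>N p \<in> \<Delta> \<longleftrightarrow> (\<forall>t. instN p t \<in> \<Delta>)"
proof
  show "\<^bold>\<forall>\<^sub>N p \<in> \<Delta> \<Longrightarrow> \<forall>t. instN p t \<in> \<Delta>"
    using AllNE by (simp flip: proves_iff)
next
  assume "\<forall>t. instN p t \<in> \<Delta>"
  then have "\<forall>t. \<^bold>\<not> instN p t \<notin> \<Delta>" by (simp add: imp_iff falsum)
  then show "\<^bold>\<forall>\<^sub>N p \<in> \<Delta>" using decides[of "\<^bold>\<forall>\<^sub>N p"] by (auto simp: decides_def)
qed

lemma allS_iff: "\<^bold>\<forall>\<^sub>S p \<in> \<Delta> \<longleftrightarrow> (\<forall>X. instS p X \<in> \<Delta>)"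
proof
  show "\<^bold>\<forall>\<^sub>S p \<in> \<Delta> \<Longrightarrow> \<forall>X. instS p X \<in> \<Delta>"
    using AllSE by (simp flip: proves_iff)
next
  assume "\<forall>X. instS p X \<in> \<Delta>"
  then have "\<forall>X. \<^bold>\<not> instS p X \<notin> \<Delta>" by (simp add: imp_iff falsum)
  then show "\<^bold>\<forall>\<^sub>S p \<in> \<Delta>" using decides[of "\<^bold>\<forall>\<^sub>S p"] by (auto simp: decides_def)
qed

lemma eq_refl: "(t \<^bold>= t) \<in> \<Delta>"
  using Refl by (simp flip: proves_iff)

lemma eq_subst: "(s \<^bold>= t) \<in> \<Delta> \<Longrightarrow> instN p s \<in> \<Delta> \<Longrightarrow> instN p t \<in> \<Delta>"
  using Leibniz[of \<Delta> s t p] by (simp add: proves_iff)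

text \<open>Leibniz is applied to the formula that equates index 0 with \<open>s\<close>; lifting
  shields \<open>s\<close> from the instantiation. The congruence facts below follow the same
  pattern.\<close>

lemma eq_sym: "(s \<^bold>= t) \<in> \<Delta> \<Longrightarrow> (t \<^bold>= s) \<in> \<Delta>"
  using eq_subst[of s t "v 0 \<^bold>= lift_tm s"] by (simp add: instN_def eq_refl)

lemma eq_trans: "(s \<^bold>= t) \<in> \<Delta> \<Longrightarrow> (t \<^bold>= u) \<in> \<Delta> \<Longrightarrow> (s \<^bold>= u) \<in> \<Delta>"
  using eq_subst[of t u "lift_tm s \<^bold>= v 0"] by (simp add: instN_def)

lemma eq_Add:
  assumes "(s \<^bold>= s') \<in> \<Delta>" and "(t \<^bold>= t') \<in> \<Delta>"
  shows "(Add s t \<^bold>= Add s' t') \<in> \<Delta>"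
proof (rule eq_trans)
  show "(Add s t \<^bold>= Add s' t) \<in> \<Delta>"
    using eq_subst[of s s' "Add (lift_tm s) (lift_tm t) \<^bold>= Add (v 0) (lift_tm t)"] assms(1)
    by (simp add: instN_def eq_refl)
  show "(Add s' t \<^bold>= Add s' t') \<in> \<Delta>"
    using eq_subst[of t t' "Add (lift_tm s') (lift_tm t) \<^bold>= Add (lift_tm s') (v 0)"] assms(2)
    by (simp add: instN_def eq_refl)
qed

lemma eq_Mul:
  assumes "(s \<^bold>= s') \<in> \<Delta>" and "(t \<^bold>= t') \<in> \<Delta>"
  shows "(Mul s t \<^bold>= Mul s' t') \<in> \<Delta>"
proof (rule eq_trans)
  show "(Mul s t \<^bold>= Mul s' t) \<in> \<Delta>"
    using eq_subst[of s s' "Mul (lift_tm s) (lift_tm t) \<^bold>= Mul (v 0) (lift_tm t)"] assms(1)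
    by (simp add: instN_def eq_refl)
  show "(Mul s' t \<^bold>= Mul s' t') \<in> \<Delta>"
    using eq_subst[of t t' "Mul (lift_tm s') (lift_tm t) \<^bold>= Mul (lift_tm s') (v 0)"] assms(2)
    by (simp add: instN_def eq_refl)
qed

lemma eq_Less:
  assumes "(s \<^bold>= s') \<in> \<Delta>" and "(t \<^bold>= t') \<in> \<Delta>"
  shows "(s \<^bold>< t) \<in> \<Delta> \<longleftrightarrow> (s' \<^bold>< t') \<in> \<Delta>"
proof -
  have "(u' \<^bold>< w') \<in> \<Delta>" if "(u \<^bold>= u') \<in> \<Delta>" "(w \<^bold>= w') \<in> \<Delta>" "(u \<^bold>< w) \<in> \<Delta>" for u u' w w'
    using eq_subst[of u u' "v 0 \<^bold>< lift_tm w"] eq_subst[of w w' "lift_tm u' \<^bold>< v 0"] that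
    by (simp add: instN_def)
  then show ?thesis using assms eq_sym by blast
qed

lemma eq_Mem:
  assumes "(s \<^bold>= s') \<in> \<Delta>"
  shows "(s \<^bold>\<in> X) \<in> \<Delta> \<longleftrightarrow> (s' \<^bold>\<in> X) \<in> \<Delta>"
  using eq_subst[of s s' "v 0 \<^bold>\<in> X"] eq_subst[of s' s "v 0 \<^bold>\<in> X"] assms eq_sym[OF assms]
  by (auto simp add: instN_def)

definition eq_class :: "tm \<Rightarrow> tm set" where
  "eq_class t = {s. (t \<^bold>= s) \<in> \<Delta>}"

lemma eq_class_eq_iff: "eq_class s = eq_class t \<longleftrightarrow> (s \<^bold>= t) \<in> \<Delta>"
  using eq_refl eq_sym eq_trans unfolding eq_class_def by blast

text \<open>Classes of provably equal terms are numbered so that the carrier can be the type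
  \<open>nat\<close>. With infinitely many classes the numbering is onto, and every number has a
  representative \<open>rep\<close>.\<close>

definition code :: "tm \<Rightarrow> nat" where
  "code t = to_nat_on (range eq_class) (eq_class t)"

lemma code_eq_iff: "code s = code t \<longleftrightarrow> (s \<^bold>= t) \<in> \<Delta>"
  unfolding code_def eq_class_eq_iff[symmetric] by (rule inj_on_eq_iff[OF inj_on_to_nat_on]) auto

definition rep :: "nat \<Rightarrow> tm" where "rep x = (SOME t. code t = x)"

definition term_model :: "nat L2_struct" where
  "term_model = \<lparr>zer = code Zero, one = code One,
     add = \<lambda>x y. code (Add (rep x) (rep y)), mul = \<lambda>x y. code (Mul (rep x) (rep y)),
     les = \<lambda>x y. (rep x \<^bold>< rep y) \<in> \<Delta>, Sets = range (\<lambda>X. {x. (rep x \<^bold>\<in> X) \<in> \<Delta>})\<rparr>"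

lemma rep_code: "(rep (code t) \<^bold>= t) \<in> \<Delta>"
  unfolding rep_def code_eq_iff[symmetric] by (rule someI) simp

lemma eval_term_model: "eval term_model (\<lambda>n. code (\<sigma> n)) t = code (subst_tm \<sigma> t)"
  by (induction t) (auto simp: term_model_def code_eq_iff eq_Add eq_Mul rep_code)

text \<open>Quantification over the type \<^typ>\<open>nat\<close> has to coincide with quantification over the values of
  terms; this is where infinitely many classes are needed.\<close>

lemma sat_term_model:
  assumes inf: "infinite (range eq_class)"
  shows "sat term_model (\<lambda>n. code (\<sigma> n)) (\<lambda>n. {x. (rep x \<^bold>\<in> \<rho> n) \<in> \<Delta>}) p \<longleftrightarrow> subst \<sigma> \<rho> p \<in> \<Delta>"
proof (induction p arbitrary: \<sigma> \<rho>)
  case (Less s t)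
  then show ?case
    using eq_Less[OF rep_code rep_code] by (simp add: eval_term_model) (simp add: term_model_def)
next
  case (Mem t X)
  then show ?case
    using eq_Mem[OF rep_code] by (simp add: eval_term_model)
next
  case (AllN p)
  have "bij_betw (to_nat_on (range eq_class)) (range eq_class) UNIV"
    using inf by (intro to_nat_on_infinite) auto
  then have "to_nat_on (range eq_class) ` range eq_class = UNIV"
    by (rule bij_betw_imp_surj_on)
  then have "surj code" by (auto simp: code_def image_image)
  then have all_code: "(\<forall>x. P x) \<longleftrightarrow> (\<forall>t. P (code t))" for P
    by (metis surjD)
  have "case_nat (code t) (\<lambda>n. code (\<sigma> n)) = (\<lambda>n. code (case_nat t \<sigma> n))" for t
    by (rule ext) (simp split: nat.split)
  then have "sat term_model (\<lambda>n. code (\<sigma> n)) (\<lambda>n. {x. (rep x \<^bold>\<in> \<rho> n) \<in> \<Delta>}) (\<^bold>\<forall>\<^sub>N p) \<longleftrightarrow>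
      (\<forall>t. subst (case_nat t \<sigma>) \<rho> p \<in> \<Delta>)"
    by (simp only: sat.simps all_code AllN)
  then show ?case by (simp add: allN_iff instN_subst_up)
next
  case (AllS p)
  have "case_nat {x. (rep x \<^bold>\<in> X) \<in> \<Delta>} (\<lambda>n. {x. (rep x \<^bold>\<in> \<rho> n) \<in> \<Delta>}) =
      (\<lambda>n. {x. (rep x \<^bold>\<in> case_nat X \<rho> n) \<in> \<Delta>})" for X
    by (rule ext) (simp split: nat.split)
  then have "sat term_model (\<lambda>n. code (\<sigma> n)) (\<lambda>n. {x. (rep x \<^bold>\<in> \<rho> n) \<in> \<Delta>}) (\<^bold>\<forall>\<^sub>S p) \<longleftrightarrow>
      (\<forall>X. subst \<sigma> (case_nat X \<rho>) p \<in> \<Delta>)"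
    using AllS[of \<sigma> "case_nat _ \<rho>"] by (simp add: term_model_def)
  then show ?case by (simp add: allS_iff instS_subst_up)
qed (auto simp: eval_term_model code_eq_iff falsum imp_iff)

text \<open>The numerals obtained from \<open>Zero\<close> by adding \<open>One\<close> are pairwise
  not provably equal.\<close>

lemma infinite_eq_classes:
  assumes zero: "\<And>t. (Add t One \<^bold>= Zero) \<notin> \<Delta>"
    and inj: "\<And>s t. (Add s One \<^bold>= Add t One) \<in> \<Delta> \<Longrightarrow> (s \<^bold>= t) \<in> \<Delta>"
  shows "infinite (range eq_class)"
proof -
  define num where "num n = ((\<lambda>t. Add t One) ^^ n) Zero" for n
  have num: "num 0 = Zero" "num (Suc n) = Add (num n) One" for n
    by (simp_all add: num_def)
  have "(num m \<^bold>= num n) \<in> \<Delta> \<longrightarrow> m = n" for m n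
  proof (induction m arbitrary: n)
    case 0
    then show ?case using zero eq_sym by (cases n) (auto simp: num)
  next
    case (Suc m)
    then show ?case using zero inj by (cases n) (auto simp: num)
  qed
  then have "inj (\<lambda>n. eq_class (num n))"
    by (auto simp: inj_def eq_class_eq_iff)
  then have "infinite (range (\<lambda>n. eq_class (num n)))"
    by (rule range_inj_infinite)
  then show ?thesis by (rule infinite_super[rotated]) auto
qed

end

text \<open>If \<open>p\<close> is not provable, the term model of a Henkin extension of
  \<open>\<Gamma>\<close> with the negation of \<open>p\<close> is a countermodel. The two successor
  axioms force it to be infinite, which is why structures over \<open>nat\<close> suffice.\<close>

theorem completeness:
  assumes "bounded_vars k \<Gamma>"
    and zero: "\<Gamma> \<turnstile> \<^bold>\<forall>\<^sub>N \<^bold>\<not> (Add (v 0) One \<^bold>= Zero)"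
    and inj: "\<Gamma> \<turnstile> \<^bold>\<forall>\<^sub>N \<^bold>\<forall>\<^sub>N (Add (v 0) One \<^bold>= Add (v 1) One \<^bold>\<longrightarrow> v 0 \<^bold>= v 1)"
    and valid: "\<And>(M :: nat L2_struct) e E. range E \<subseteq> Sets M \<Longrightarrow> \<forall>q\<in>\<Gamma>. sat M e E q \<Longrightarrow> sat M e E p"
  shows "\<Gamma> \<turnstile> p"
proof (rule ccontr)
  assume "\<not> (\<Gamma> \<turnstile> p)"
  then have "consistent (insert (\<^bold>\<not> p) \<Gamma>)"
    using RAA unfolding consistent_def by blast
  then obtain \<Delta> where \<Delta>: "insert (\<^bold>\<not> p) \<Gamma> \<subseteq> \<Delta>" "consistent \<Delta>" "\<And>q. decides \<Delta> q"
    using henkin_extension bounded_vars_insert assms(1) by metis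
  interpret henkin_theory \<Delta> by standard (use \<Delta> in auto)
  have "\<^bold>\<forall>\<^sub>N \<^bold>\<not> (Add (v 0) One \<^bold>= Zero) \<in> \<Delta>"
    and "\<^bold>\<forall>\<^sub>N \<^bold>\<forall>\<^sub>N (Add (v 0) One \<^bold>= Add (v 1) One \<^bold>\<longrightarrow> v 0 \<^bold>= v 1) \<in> \<Delta>"
    using proves_mono zero inj \<Delta>(1) by (meson insert_subset proves_iff)+
  then have "infinite (range eq_class)"
    by (intro infinite_eq_classes)
      (auto simp: allN_iff instN_def imp_iff falsum lift_tm_def subst_tm_subst_tm)
  \<comment> \<open>Each variable denotes its own class, so that truth in the term model is
    membership in the theory.\<close>
  then have sat_iff: "sat term_model (\<lambda>n. code (Var n)) (\<lambda>n. {x. (rep x \<^bold>\<in> id n) \<in> \<Delta>}) q \<longleftrightarrow> q \<in> \<Delta>" for q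
    using sat_term_model[of Var id q] by (simp only: subst_Var_id simp_thms)
  have "sat term_model (\<lambda>n. code (Var n)) (\<lambda>n. {x. (rep x \<^bold>\<in> id n) \<in> \<Delta>}) p"
  proof (rule valid)
    show "range (\<lambda>n. {x. (rep x \<^bold>\<in> id n) \<in> \<Delta>}) \<subseteq> Sets term_model"
      by (auto simp: term_model_def)
  qed (use \<Delta>(1) in \<open>auto simp only: sat_iff\<close>)
  then have "p \<in> \<Delta>" by (simp only: sat_iff)
  moreover have "p \<notin> \<Delta>"
    using \<Delta>(1) by (simp add: imp_iff falsum)
  ultimately show False by contradiction
qed

section \<open>Models of RCA0\<close>

lemma eval_cong: "(\<And>n. n < bound_tm t \<Longrightarrow> e n = e' n) \<Longrightarrow> eval M e t = eval M e' t"
  by (induction t) auto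

lemma sat_cong:
  assumes "\<And>n. n < boundN p \<Longrightarrow> e n = e' n" and "\<And>n. n < boundS p \<Longrightarrow> E n = E' n"
  shows "sat M e E p \<longleftrightarrow> sat M e' E' p"
  using assms
proof (induction p arbitrary: e e' E E')
  case (Eq s t)
  then show ?case using eval_cong[of s e e' M] eval_cong[of t e e' M] by simp
next
  case (Less s t)
  then show ?case using eval_cong[of s e e' M] eval_cong[of t e e' M] by simp
next
  case (Mem t X)
  then show ?case using eval_cong[of t e e' M] by simp
next
  case (Imp p q)
  have "sat M e E p \<longleftrightarrow> sat M e' E' p" "sat M e E q \<longleftrightarrow> sat M e' E' q"
    using Imp.prems by (auto intro!: Imp.IH)
  then show ?case by simp
next
  case (AllN p)
  have "sat M (case_nat x e) E p \<longleftrightarrow> sat M (case_nat x e') E' p" for x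
    using AllN.prems by (intro AllN.IH) (auto split: nat.split)
  then show ?case by simp
next
  case (AllS p)
  have "sat M e (case_nat X E) p \<longleftrightarrow> sat M e' (case_nat X E') p" for X
    using AllS.prems by (intro AllS.IH) (auto split: nat.split)
  then show ?case by simp
qed simp

text \<open>Of \<open>Suc k\<close> quantifiers the outermost binds what is index \<open>k\<close>
  in the matrix, hence the value \<open>e' k\<close> for it in the induction.\<close>

lemma sat_AllN_funpow:
  "sat M e E ((AllN ^^ k) p) \<Longrightarrow> sat M (\<lambda>n. if n < k then e' n else e (n - k)) E p"
proof (induction k arbitrary: e)
  case (Suc k)
  have "(\<lambda>n. if n < k then e' n else case_nat (e' k) e (n - k)) =
      (\<lambda>n. if n < Suc k then e' n else e (n - Suc k))"
    by (rule ext) (auto simp: less_Suc_eq diff_Suc split: nat.split)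
  then show ?case using Suc.IH[of "case_nat (e' k) e"] Suc.prems by simp
qed simp

lemma sat_AllS_funpow:
  "sat M e E ((AllS ^^ k) p) \<Longrightarrow> range E' \<subseteq> Sets M \<Longrightarrow>
    sat M e (\<lambda>n. if n < k then E' n else E (n - k)) p"
proof (induction k arbitrary: E)
  case (Suc k)
  have "(\<lambda>n. if n < k then E' n else case_nat (E' k) E (n - k)) =
      (\<lambda>n. if n < Suc k then E' n else E (n - Suc k))"
    by (rule ext) (auto simp: less_Suc_eq diff_Suc split: nat.split)
  moreover have "sat M e (case_nat (E' k) E) ((AllS ^^ k) p)"
    using Suc.prems by auto
  ultimately show ?case using Suc.IH[of "case_nat (E' k) E"] Suc.prems(2) by simp
qed simp

lemma sat_uclosureD:
  assumes "sat M e0 E0 (uclosure p)" and "range E \<subseteq> Sets M"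
  shows "sat M e E p"
proof -
  let ?e = "\<lambda>n. if n < boundN p then e n else e0 (n - boundN p)"
  have "sat M ?e E0 ((AllS ^^ boundS p) p)"
    using assms(1) unfolding uclosure_def by (rule sat_AllN_funpow)
  then have "sat M ?e (\<lambda>n. if n < boundS p then E n else E0 (n - boundS p)) p"
    using assms(2) by (rule sat_AllS_funpow)
  then show ?thesis
    by (rule sat_cong[THEN iffD1, rotated 2]) simp_all
qed

lemma bounded_vars_uclosure: "bounded_vars 0 (uclosure ` A)"
proof -
  have "boundN ((AllN ^^ k) p) = boundN p - k" "boundS ((AllN ^^ k) p) = boundS p"
    "boundN ((AllS ^^ k) p) = boundN p" "boundS ((AllS ^^ k) p) = boundS p - k" for k p
    by (induction k) auto
  then show ?thesis by (simp add: bounded_vars_def uclosure_def)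
qed

section \<open>Bounded formulas\<close>

lemma bounded_subst: "bounded p \<Longrightarrow> bounded (subst \<sigma> \<rho> p)"
proof (induction arbitrary: \<sigma> \<rho> rule: bounded.induct)
  case (6 p t)
  then show ?case by (simp add: subst_tm_up_lift_tm bounded.intros)
qed (auto intro: bounded.intros)

lemma bounded_liftN: "bounded p \<Longrightarrow> bounded (liftN p)"
  unfolding liftN_def by (rule bounded_subst)

definition BAll :: "tm \<Rightarrow> fm \<Rightarrow> fm" where
  "BAll t p = (\<^bold>\<forall>\<^sub>N (v 0 \<^bold>< lift_tm t \<^bold>\<longrightarrow> p))"

definition BEx :: "tm \<Rightarrow> fm \<Rightarrow> fm" where
  "BEx t p = \<^bold>\<not> BAll t (\<^bold>\<not> p)"

lemma bounded_intros:
  "bounded p \<Longrightarrow> bounded (BAll t p)" "bounded p \<Longrightarrow> bounded (BEx t p)"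
  "bounded (val F x s y)"
  by (auto simp: BAll_def BEx_def val_def intro!: bounded.intros)

lemmas bounded_all_intros = bounded.intros(1-5) bounded_intros bounded_subst

lemma eval_lift_tm [simp]: "eval M (case_nat x e) (lift_tm t) = eval M e t"
  by (simp add: lift_tm_def eval_subst)

lemma sat_BAll [simp]:
  "sat M e E (BAll t p) \<longleftrightarrow> (\<forall>x. les M x (eval M e t) \<longrightarrow> sat M (case_nat x e) E p)"
  by (simp add: BAll_def)

lemma sat_BEx [simp]:
  "sat M e E (BEx t p) \<longleftrightarrow> (\<exists>x. les M x (eval M e t) \<and> sat M (case_nat x e) E p)"
  by (simp add: BEx_def)

lemma sat_val [simp]:
  "sat M e E (val F x s y) \<longleftrightarrow> pr M (pr M (eval M e x) (eval M e s)) (eval M e y) \<in> E F"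
  by (simp add: val_def)

section \<open>Induction and comprehension inside a model\<close>

locale rca0_model =
  fixes M :: "'a L2_struct"
  assumes sat_RCA0: "\<And>e E p. range E \<subseteq> Sets M \<Longrightarrow> uclosure p \<in> RCA0 \<Longrightarrow> sat M e E p"
    and Sets_nonempty: "Sets M \<noteq> {}"
begin

abbreviation plus_M (infixl "\<oplus>" 65) where "x \<oplus> y \<equiv> add M x y"
abbreviation times_M (infixl "\<otimes>" 70) where "x \<otimes> y \<equiv> mul M x y"
abbreviation less_M (infix "\<prec>" 50) where "x \<prec> y \<equiv> les M x y"
abbreviation zero_M ("\<zero>") where "\<zero> \<equiv> zer M"
abbreviation one_M ("\<one>") where "\<one> \<equiv> one M"
abbreviation pr_M ("\<langle>_, _\<rangle>") where "\<langle>x, y\<rangle> \<equiv> pr M x y"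

text \<open>A dummy set assignment, for formulas of pure arithmetic.\<close>

definition some_sets :: "nat \<Rightarrow> 'a set" where "some_sets n = (SOME X. X \<in> Sets M)"

lemma range_some_sets: "range some_sets \<subseteq> Sets M"
  using Sets_nonempty by (auto simp: some_sets_def some_in_eq)

lemma sat_basic: "p \<in> basic_axioms \<Longrightarrow> sat M e some_sets p"
  by (rule sat_RCA0[OF range_some_sets]) (auto simp: RCA0_def)

lemma
  shows succ_neq_zero: "x \<oplus> \<one> \<noteq> \<zero>"
    and succ_inj: "x \<oplus> \<one> = y \<oplus> \<one> \<Longrightarrow> x = y"
    and add_zero: "x \<oplus> \<zero> = x"
    and add_succ: "x \<oplus> (y \<oplus> \<one>) = x \<oplus> y \<oplus> \<one>"
    and mul_zero: "x \<otimes> \<zero> = \<zero>"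
    and mul_succ: "x \<otimes> (y \<oplus> \<one>) = x \<otimes> y \<oplus> x"
    and not_less_zero: "\<not> x \<prec> \<zero>"
    and less_succ: "x \<prec> y \<oplus> \<one> \<longleftrightarrow> x \<prec> y \<or> x = y"
proof -
  have *: "\<forall>p\<in>basic_axioms. sat M (case_nat x (\<lambda>_. y)) some_sets p"
    using sat_basic by blast
  show "x \<oplus> \<one> \<noteq> \<zero>" "x \<oplus> \<one> = y \<oplus> \<one> \<Longrightarrow> x = y" "x \<oplus> \<zero> = x"
    "x \<oplus> (y \<oplus> \<one>) = x \<oplus> y \<oplus> \<one>" "x \<otimes> \<zero> = \<zero>" "x \<otimes> (y \<oplus> \<one>) = x \<otimes> y \<oplus> x"
    "\<not> x \<prec> \<zero>" "x \<prec> y \<oplus> \<one> \<longleftrightarrow> x \<prec> y \<or> x = y"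
    using * by (auto simp: basic_axioms_def)
qed

text \<open>In \<open>p\<close>, index 0 is the existential witness and index 1 the induction
  variable.\<close>

lemma sigma_induct:
  assumes "bounded p" and "range E \<subseteq> Sets M"
    and base: "\<exists>z. sat M (case_nat z (case_nat \<zero> e)) E p"
    and step: "\<And>x. \<exists>z. sat M (case_nat z (case_nat x e)) E p \<Longrightarrow>
      \<exists>z. sat M (case_nat z (case_nat (x \<oplus> \<one>) e)) E p"
  shows "\<exists>z. sat M (case_nat z (case_nat x e)) E p"
proof -
  let ?p = "\<^bold>\<exists>\<^sub>N p"
  have "uclosure (induction_ax ?p) \<in> RCA0"
    using assms(1) unfolding RCA0_def Sigma01_def by blast
  then have ax: "sat M e E (induction_ax ?p)"
    by (rule sat_RCA0[OF assms(2)])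
  have env: "(\<lambda>n. eval M (case_nat y e) (case_nat (Add (v 0) One) (\<lambda>n. v (Suc n)) n)) =
      case_nat (y \<oplus> \<one>) e" for y
    by (rule ext) (simp split: nat.split)
  show ?thesis
    using ax base step unfolding induction_ax_def sat.simps sat_instN sat_subst env id_apply
    by auto
qed

text \<open>Lifting a bounded formula makes room for a vacuous existential quantifier, which brings
  it into the form required by the scheme.\<close>

lemma bounded_induct:
  assumes "bounded p" and "range E \<subseteq> Sets M"
    and "sat M (case_nat \<zero> e) E p"
    and "\<And>x. sat M (case_nat x e) E p \<Longrightarrow> sat M (case_nat (x \<oplus> \<one>) e) E p"
  shows "sat M (case_nat x e) E p"
  using sigma_induct[of "liftN p" E e x] assms by (simp add: sat_liftN bounded_liftN)

lemma delta_comprehension: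
  assumes "bounded p" and "bounded q" and "range E \<subseteq> Sets M"
    and "\<And>x. (\<exists>z. sat M (case_nat z (case_nat x e)) E p) \<longleftrightarrow> (\<forall>z. sat M (case_nat z (case_nat x e)) E q)"
  shows "{x. \<exists>z. sat M (case_nat z (case_nat x e)) E p} \<in> Sets M"
proof -
  have "uclosure (comprehension (\<^bold>\<exists>\<^sub>N p) (\<^bold>\<forall>\<^sub>N q)) \<in> RCA0"
    using assms(1,2) unfolding RCA0_def Sigma01_def Pi01_def by blast
  then have "sat M e E (comprehension (\<^bold>\<exists>\<^sub>N p) (\<^bold>\<forall>\<^sub>N q))"
    by (rule sat_RCA0[OF assms(3)])
  moreover have "sat M e E (comprehension (\<^bold>\<exists>\<^sub>N p) (\<^bold>\<forall>\<^sub>N q)) \<longleftrightarrow>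
      ((\<forall>x. (\<exists>z. sat M (case_nat z (case_nat x e)) E p) \<longleftrightarrow>
            (\<forall>z. sat M (case_nat z (case_nat x e)) E q)) \<longrightarrow>
       (\<exists>X\<in>Sets M. \<forall>x. x \<in> X \<longleftrightarrow> (\<exists>z. sat M (case_nat z (case_nat x e)) E p)))"
    by (simp only: comprehension_def reading_simps sat_liftS) blast
  ultimately obtain X where X: "X \<in> Sets M" "\<forall>x. x \<in> X \<longleftrightarrow> (\<exists>z. sat M (case_nat z (case_nat x e)) E p)"
    using assms(4) by blast
  then have "X = {x. \<exists>z. sat M (case_nat z (case_nat x e)) E p}" by auto
  with X(1) show ?thesis by simp
qed

lemma bounded_comprehension:
  assumes "bounded p" and "range E \<subseteq> Sets M"
  shows "{x. sat M (case_nat x e) E p} \<in> Sets M"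
  using delta_comprehension[of "liftN p" "liftN p" E e] assms
  by (simp add: sat_liftN bounded_liftN)

subsection \<open>Arithmetic\<close>

lemmas arith_induct = bounded_induct[OF _ range_some_sets]

text \<open>The pattern of the arithmetical inductions: the induction variable sits at index 0 and
  the parameters above it.\<close>

lemma add_assoc: "x \<oplus> y \<oplus> z = x \<oplus> (y \<oplus> z)"
proof -
  have "sat M (case_nat z (case_nat y (\<lambda>_. x))) some_sets
      (Add (Add (v 2) (v 1)) (v 0) \<^bold>= Add (v 2) (Add (v 1) (v 0)))"
    by (rule arith_induct) (simp_all add: bounded_all_intros numeral_2_eq_2 add_zero add_succ)
  then show ?thesis by (simp add: numeral_2_eq_2)
qed

lemma zero_add: "\<zero> \<oplus> x = x"
proof -
  have "sat M (case_nat x (\<lambda>_. x)) some_sets (Add Zero (v 0) \<^bold>= v 0)"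
    by (rule arith_induct) (simp_all add: bounded_all_intros add_zero add_succ)
  then show ?thesis by simp
qed

lemma succ_add: "x \<oplus> \<one> \<oplus> y = x \<oplus> y \<oplus> \<one>"
proof -
  have "sat M (case_nat y (\<lambda>_. x)) some_sets (Add (Add (v 1) One) (v 0) \<^bold>= Add (Add (v 1) (v 0)) One)"
    by (rule arith_induct) (simp_all add: bounded_all_intros add_zero add_succ)
  then show ?thesis by simp
qed

lemma add_comm: "x \<oplus> y = y \<oplus> x"
proof -
  have "sat M (case_nat y (\<lambda>_. x)) some_sets (Add (v 1) (v 0) \<^bold>= Add (v 0) (v 1))"
    by (rule arith_induct) (simp_all add: bounded_all_intros add_zero add_succ zero_add succ_add)
  then show ?thesis by simp
qed

lemma add_left_comm: "x \<oplus> (y \<oplus> z) = y \<oplus> (x \<oplus> z)"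
  using add_assoc add_comm by metis

lemmas add_ac = add_assoc add_comm add_left_comm

lemma distrib_left: "x \<otimes> (y \<oplus> z) = x \<otimes> y \<oplus> x \<otimes> z"
proof -
  have "sat M (case_nat z (case_nat y (\<lambda>_. x))) some_sets
      (Mul (v 2) (Add (v 1) (v 0)) \<^bold>= Add (Mul (v 2) (v 1)) (Mul (v 2) (v 0)))"
    by (rule arith_induct)
      (simp_all add: bounded_all_intros numeral_2_eq_2 add_zero mul_zero mul_succ flip: add_assoc)
  then show ?thesis by (simp add: numeral_2_eq_2)
qed

lemma distrib_right: "(x \<oplus> y) \<otimes> z = x \<otimes> z \<oplus> y \<otimes> z"
proof -
  have "sat M (case_nat z (case_nat y (\<lambda>_. x))) some_sets
      (Mul (Add (v 2) (v 1)) (v 0) \<^bold>= Add (Mul (v 2) (v 0)) (Mul (v 1) (v 0)))"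
  proof (rule arith_induct, goal_cases)
    case (3 z)
    then have "(x \<oplus> y) \<otimes> z = x \<otimes> z \<oplus> y \<otimes> z" by (simp add: numeral_2_eq_2)
    then have "(x \<oplus> y) \<otimes> (z \<oplus> \<one>) = x \<otimes> (z \<oplus> \<one>) \<oplus> y \<otimes> (z \<oplus> \<one>)"
      unfolding mul_succ by (simp only: add_ac)
    then show ?case by (simp add: numeral_2_eq_2)
  qed (simp_all add: bounded_all_intros numeral_2_eq_2 add_zero mul_zero)
  then show ?thesis by (simp add: numeral_2_eq_2)
qed

lemma add_cancel: "x \<oplus> z = y \<oplus> z \<Longrightarrow> x = y"
proof -
  have "sat M (case_nat z (case_nat y (\<lambda>_. x))) some_sets
      (Add (v 2) (v 0) \<^bold>= Add (v 1) (v 0) \<^bold>\<longrightarrow> v 2 \<^bold>= v 1)"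
    by (rule arith_induct)
      (auto simp: bounded_all_intros numeral_2_eq_2 add_zero simp flip: add_assoc dest: succ_inj)
  then show "x \<oplus> z = y \<oplus> z \<Longrightarrow> x = y" by (simp add: numeral_2_eq_2)
qed

lemma add_left_cancel: "z \<oplus> x = z \<oplus> y \<longleftrightarrow> x = y"
  using add_cancel[of x z y] add_comm by metis

lemma less_iff_add: "x \<prec> y \<longleftrightarrow> (\<exists>z. y = x \<oplus> (z \<oplus> \<one>))"
proof
  \<comment> \<open>The existential quantifier is pulled in front of the implication so that the
    induction formula has the required form; where \<open>x\<close> is not below \<open>y\<close>,
    any \<open>z\<close> is a witness.\<close>
  have "\<exists>z. sat M (case_nat z (case_nat y (\<lambda>_. x))) some_sets
      (v 2 \<^bold>< v 1 \<^bold>\<longrightarrow> v 1 \<^bold>= Add (v 2) (Add (v 0) One))"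
  proof (rule sigma_induct[OF _ range_some_sets], goal_cases)
    case (3 y)
    then obtain z where z: "x \<prec> y \<Longrightarrow> y = x \<oplus> (z \<oplus> \<one>)"
      by (auto simp: numeral_2_eq_2)
    have "\<exists>z. x \<prec> y \<oplus> \<one> \<longrightarrow> y \<oplus> \<one> = x \<oplus> (z \<oplus> \<one>)"
    proof (cases "x \<prec> y")
      case True
      then show ?thesis using z by (intro exI[of _ "z \<oplus> \<one>"]) (simp add: add_succ)
    next
      case False
      then show ?thesis by (intro exI[of _ \<zero>]) (simp add: less_succ zero_add)
    qed
    then show ?case by (simp add: numeral_2_eq_2)
  qed (simp_all add: bounded_all_intros numeral_2_eq_2 not_less_zero)
  then show "x \<prec> y \<Longrightarrow> \<exists>z. y = x \<oplus> (z \<oplus> \<one>)" by (simp add: numeral_2_eq_2)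
next
  have "sat M (case_nat z (\<lambda>_. x)) some_sets (v 1 \<^bold>< Add (v 1) (Add (v 0) One))" for z
    by (rule arith_induct) (simp_all add: bounded_all_intros add_succ add_zero less_succ)
  then show "\<exists>z. y = x \<oplus> (z \<oplus> \<one>) \<Longrightarrow> x \<prec> y" by auto
qed

lemma less_irrefl: "\<not> x \<prec> x"
proof
  assume "x \<prec> x"
  then obtain z where "x = x \<oplus> (z \<oplus> \<one>)" using less_iff_add by blast
  then have "x \<oplus> \<zero> = x \<oplus> (z \<oplus> \<one>)" by (simp only: add_zero)
  then show False unfolding add_left_cancel using succ_neq_zero by metis
qed

lemma less_trans: "x \<prec> y \<Longrightarrow> y \<prec> z \<Longrightarrow> x \<prec> z"
  by (auto simp: less_iff_add) (metis add_assoc)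

lemma zero_less_succ: "\<zero> \<prec> x \<oplus> \<one>"
  by (auto simp: less_iff_add zero_add)

lemma less_linear: "x \<prec> y \<or> x = y \<or> y \<prec> x"
proof -
  have zero: "x = \<zero> \<or> \<zero> \<prec> x" for x
  proof -
    have "sat M (case_nat x (\<lambda>_. x)) some_sets (v 0 \<^bold>= Zero \<^bold>\<or> Zero \<^bold>< v 0)"
      by (rule arith_induct) (simp_all add: bounded_all_intros zero_less_succ)
    then show ?thesis by auto
  qed
  have "sat M (case_nat y (\<lambda>_. x)) some_sets (v 1 \<^bold>< v 0 \<^bold>\<or> v 1 \<^bold>= v 0 \<^bold>\<or> v 0 \<^bold>< v 1)"
  proof (rule arith_induct, goal_cases)
    case 2
    then show ?case using zero[of x] by auto
  next
    case (3 y)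
    have "x = y \<oplus> \<one> \<or> y \<oplus> \<one> \<prec> x" if yx: "y \<prec> x"
    proof -
      obtain z where z: "x = y \<oplus> (z \<oplus> \<one>)" using yx by (auto simp: less_iff_add)
      show ?thesis
      proof (cases "z = \<zero>")
        case True
        then show ?thesis using z by (simp add: zero_add)
      next
        case False
        then obtain w where "z = w \<oplus> \<one>" using zero[of z] by (auto simp: less_iff_add zero_add)
        then show ?thesis using z by (auto simp: less_iff_add add_ac)
      qed
    qed
    then show ?case using 3 by (auto simp: less_succ)
  qed (simp add: bounded_all_intros)
  then show ?thesis by auto
qed

lemma less_addD:
  assumes "x \<oplus> y \<prec> z"
  shows "x \<prec> z" and "y \<prec> z"
proof -
  obtain w where "z = x \<oplus> y \<oplus> (w \<oplus> \<one>)"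
    using assms by (auto simp: less_iff_add)
  then have "z = x \<oplus> (y \<oplus> w \<oplus> \<one>)" "z = y \<oplus> (x \<oplus> w \<oplus> \<one>)"
    by (simp_all add: add_ac)
  then show "x \<prec> z" "y \<prec> z"
    unfolding less_iff_add by blast+
qed

text \<open>With k = x + y the first code is at most k^2 + k, whereas the second is at least (k +
  1)^2. The calculation exhibits the difference as a successor.\<close>

lemma pr_eq_less_False:
  assumes "\<langle>x, y\<rangle> = \<langle>x', y'\<rangle>" and "x \<oplus> y \<prec> x' \<oplus> y'"
  shows False
proof -
  obtain d where d: "x' \<oplus> y' = x \<oplus> y \<oplus> (d \<oplus> \<one>)"
    using assms(2) less_iff_add by blast
  define k where "k = x \<oplus> y"
  have "k \<otimes> k \<oplus> x = (k \<oplus> (d \<oplus> \<one>)) \<otimes> (k \<oplus> (d \<oplus> \<one>)) \<oplus> x'"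
    using assms(1) d by (simp add: pr_def k_def)
  also have "\<dots> = k \<otimes> k \<oplus> (x \<oplus> (y \<oplus> k \<otimes> d \<oplus> (d \<oplus> \<one>) \<otimes> k \<oplus> (d \<oplus> \<one>) \<otimes> d \<oplus> d \<oplus> x' \<oplus> \<one>))"
    \<comment> \<open>\<open>k\<close> stays folded until the products are expanded; unfolding it
      afterwards exposes the summand \<open>x\<close>.\<close>
    by (simp add: distrib_left[of "_ \<oplus> _" k "_ \<oplus> _"] distrib_right[of k "_ \<oplus> _"] mul_succ)
      (simp add: k_def add_ac)
  finally have "x \<oplus> \<zero> = x \<oplus> (y \<oplus> k \<otimes> d \<oplus> (d \<oplus> \<one>) \<otimes> k \<oplus> (d \<oplus> \<one>) \<otimes> d \<oplus> d \<oplus> x' \<oplus> \<one>)"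
    unfolding add_left_cancel add_zero .
  then show False
    unfolding add_left_cancel using succ_neq_zero by metis
qed

lemma pr_inject: "\<langle>x, y\<rangle> = \<langle>x', y'\<rangle> \<longleftrightarrow> x = x' \<and> y = y'"
proof
  assume eq: "\<langle>x, y\<rangle> = \<langle>x', y'\<rangle>"
  then have "x \<oplus> y = x' \<oplus> y'"
    using less_linear pr_eq_less_False eq[symmetric] by blast
  moreover from this eq have "x = x'"
    by (simp add: pr_def add_left_cancel)
  ultimately show "x = x' \<and> y = y'" by (simp add: add_left_cancel)
qed simp

text \<open>These make decoding a bounded search. For the second bound, k = x + y is zero or some w
  + 1, and then k * k = k * w + k contains the summand \<open>y\<close>.\<close>

lemma pr_bounds: "x \<prec> \<langle>x, y\<rangle> \<oplus> \<one>" "y \<prec> \<langle>x, y\<rangle> \<oplus> \<one>"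
proof -
  have "\<langle>x, y\<rangle> \<oplus> \<one> = x \<oplus> ((x \<oplus> y) \<otimes> (x \<oplus> y) \<oplus> \<one>)"
    by (simp add: pr_def add_ac)
  then show "x \<prec> \<langle>x, y\<rangle> \<oplus> \<one>"
    unfolding less_iff_add by blast
  show "y \<prec> \<langle>x, y\<rangle> \<oplus> \<one>"
  proof (cases "x \<oplus> y = \<zero>")
    case True
    then have "y \<prec> \<one>" using less_succ[of y \<zero>] zero_add less_linear[of y \<zero>] not_less_zero less_addD(2)
      by (metis zero_less_succ)
    then show ?thesis using True
      by (metis less_linear zero_less_succ less_trans less_succ not_less_zero zero_add)
  next
    case False
    then have "\<zero> \<prec> x \<oplus> y" using less_linear not_less_zero by blast
    then obtain w where w: "x \<oplus> y = w \<oplus> \<one>"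
      by (auto simp: less_iff_add[of \<zero>] zero_add)
    have "\<langle>x, y\<rangle> \<oplus> \<one> = (x \<oplus> y) \<otimes> w \<oplus> (x \<oplus> y) \<oplus> x \<oplus> \<one>"
      unfolding pr_def by (subst (2) w) (simp only: mul_succ)
    also have "\<dots> = y \<oplus> ((x \<oplus> y) \<otimes> w \<oplus> x \<oplus> x \<oplus> \<one>)"
      by (simp add: add_ac)
    finally show ?thesis
      unfolding less_iff_add by blast
  qed
qed

text \<open>Doubling a gap of at least 1 yields a gap of at least 2, which a single successor cannot
  close. This will separate the colours 2i and 2i + 1.\<close>

lemma double_less_neq:
  assumes "x \<prec> y"
  shows "x \<oplus> x \<noteq> y \<oplus> y" and "x \<oplus> x \<oplus> \<one> \<noteq> y \<oplus> y" and "y \<oplus> y \<oplus> \<one> \<noteq> x \<oplus> x"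
proof -
  obtain d where y: "y = x \<oplus> (d \<oplus> \<one>)" using assms less_iff_add by blast
  then have yy: "y \<oplus> y = x \<oplus> x \<oplus> (d \<oplus> d \<oplus> \<one> \<oplus> \<one>)" by (simp add: add_ac)
  show "x \<oplus> x \<noteq> y \<oplus> y"
    unfolding yy using add_left_cancel[of "x \<oplus> x" \<zero>] succ_neq_zero by (metis add_zero)
  show "x \<oplus> x \<oplus> \<one> \<noteq> y \<oplus> y"
    unfolding yy using add_left_cancel succ_neq_zero succ_inj by (metis zero_add)
  have "y \<oplus> y \<oplus> \<one> = x \<oplus> x \<oplus> (d \<oplus> d \<oplus> \<one> \<oplus> \<one> \<oplus> \<one>)"
    unfolding yy by (simp add: add_ac)
  then show "y \<oplus> y \<oplus> \<one> \<noteq> x \<oplus> x"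
    using add_left_cancel[of "x \<oplus> x" _ \<zero>] succ_neq_zero by (metis add_zero)
qed

lemma double_inject: "x \<oplus> x = y \<oplus> y \<longleftrightarrow> x = y"
  using less_linear double_less_neq(1) by metis

lemma double_neq_succ_double: "x \<oplus> x \<noteq> y \<oplus> y \<oplus> \<one>"
proof -
  have "x \<oplus> x \<noteq> x \<oplus> x \<oplus> \<one>"
    using less_succ[of "x \<oplus> x" "x \<oplus> x"] less_irrefl by metis
  then show ?thesis using less_linear[of x y] double_less_neq(2,3) by metis
qed

lemma less_double_succ: "x \<prec> x \<oplus> x \<oplus> \<one>"
  unfolding less_iff_add by (auto simp: add_assoc)

subsection \<open>The combinatorial argument\<close>

text \<open>Comprehension for binary relations, where \<open>q\<close> presents the complement of
  \<open>p\<close> existentially. A number is decoded by a search bounded by itself.\<close>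

lemma pair_comprehension:
  assumes bd: "bounded p" "bounded q" and E: "range E \<subseteq> Sets M"
    and compl: "\<And>x s. (\<exists>z. sat M (case_nat z (case_nat s (case_nat x e))) E p) \<longleftrightarrow>
      \<not> (\<exists>z. sat M (case_nat z (case_nat s (case_nat x e))) E q)"
  shows "\<exists>T\<in>Sets M. (\<forall>n\<in>T. \<exists>x s. n = \<langle>x, s\<rangle>) \<and>
    (\<forall>x s. \<langle>x, s\<rangle> \<in> T \<longleftrightarrow> (\<exists>z. sat M (case_nat z (case_nat s (case_nat x e))) E p))"
proof -
  \<comment> \<open>Inside the two bounded quantifiers of \<open>dec\<close> the assignment is s, x,
    z, n, followed by \<open>e\<close>; \<open>\<sigma>\<close> restores the order z, s, x and skips
    \<open>n\<close>.\<close>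
  define \<sigma> where "\<sigma> = case_nat (v 2) (case_nat (v 0) (case_nat (v 1) (\<lambda>k. v (k + 4))))"
  define dec where "dec r = BEx (Add (v 1) One) (BEx (Add (v 2) One) (v 3 \<^bold>= pair (v 1) (v 0) \<^bold>\<and> subst \<sigma> id r))"
    for r
  have env: "(\<lambda>k. eval M (case_nat s (case_nat x (case_nat z (case_nat n e)))) (\<sigma> k)) =
      case_nat z (case_nat s (case_nat x e))" for s x z n
    by (rule ext) (simp add: \<sigma>_def numeral_2_eq_2 split: nat.split)
  have sat_dec: "sat M (case_nat z (case_nat n e)) E (dec r) \<longleftrightarrow>
      (\<exists>x s. n = \<langle>x, s\<rangle> \<and> sat M (case_nat z (case_nat s (case_nat x e))) E r)" for z n r
  proof -
    have "sat M (case_nat z (case_nat n e)) E (dec r) \<longleftrightarrow> (\<exists>x s. x \<prec> n \<oplus> \<one> \<and> s \<prec> n \<oplus> \<one> \<and>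
        n = \<langle>x, s\<rangle> \<and> sat M (case_nat z (case_nat s (case_nat x e))) E r)"
      by (auto simp: dec_def sat_subst env numeral_2_eq_2 numeral_3_eq_3)
    then show ?thesis using pr_bounds by blast
  qed
  have bd_dec: "bounded r \<Longrightarrow> bounded (dec r)" for r
    by (simp add: dec_def bounded_all_intros)
  define T where "T = {n. \<exists>z. sat M (case_nat z (case_nat n e)) E (dec p)}"
  have "T \<in> Sets M"
    unfolding T_def
  \<comment> \<open>The negation of \<open>q\<close> is placed inside the decoding, so that both
    sides of the equivalence fail when \<open>n\<close> is not a pair.\<close>
  proof (rule delta_comprehension[OF bd_dec[OF bd(1)] bd_dec[OF bounded.intros(5)[OF bd(2) bounded.intros(4)]] E])
    fix n
    show "(\<exists>z. sat M (case_nat z (case_nat n e)) E (dec p)) \<longleftrightarrow>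
        (\<forall>z. sat M (case_nat z (case_nat n e)) E (dec (\<^bold>\<not> q)))"
    proof (cases "\<exists>x s. n = \<langle>x, s\<rangle>")
      case True
      then obtain x s where "n = \<langle>x, s\<rangle>" by blast
      then show ?thesis using compl[of s x] by (simp add: sat_dec pr_inject)
    qed (simp add: sat_dec)
  qed
  moreover have "(\<forall>n\<in>T. \<exists>x s. n = \<langle>x, s\<rangle>) \<and>
    (\<forall>x s. \<langle>x, s\<rangle> \<in> T \<longleftrightarrow> (\<exists>z. sat M (case_nat z (case_nat s (case_nat x e))) E p))"
    by (auto simp: T_def sat_dec pr_inject)
  ultimately show ?thesis by blast
qed

lemma least_element:
  assumes "X \<in> Sets M" and "x \<in> X"
  shows "\<exists>s\<in>X. \<forall>y. y \<prec> s \<longrightarrow> y \<notin> X"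
proof (rule ccontr)
  assume no: "\<not> ?thesis"
  \<comment> \<open>Without a least element, bounded induction on \<open>y\<close> shows that
    \<open>X\<close> has no element below \<open>y\<close>.\<close>
  have "sat M (case_nat y (\<lambda>_. x)) (\<lambda>_. X) (BAll (v 0) (\<^bold>\<not> (v 0 \<^bold>\<in> 0)))" for y
    by (rule bounded_induct) (use assms(1) no in \<open>auto simp: bounded_all_intros not_less_zero less_succ\<close>)
  from this[of "x \<oplus> \<one>"] show False
    using assms(2) by (auto simp: less_succ)
qed

section \<open>Tournaments inside the model\<close>

definition unbounded :: "'a set \<Rightarrow> bool" where
  "unbounded A \<longleftrightarrow> (\<forall>x. \<exists>y\<in>A. x \<prec> y)"

definition tournament :: "'a set \<Rightarrow> 'a set \<Rightarrow> bool" where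
  "tournament D T \<longleftrightarrow>
    T \<subseteq> {\<langle>x, y\<rangle> | x y. x \<in> D \<and> y \<in> D} \<and> (\<forall>x\<in>D. \<langle>x, x\<rangle> \<notin> T) \<and>
    (\<forall>x\<in>D. \<forall>y\<in>D. x \<noteq> y \<longrightarrow> \<langle>x, y\<rangle> \<in> T \<and> \<langle>y, x\<rangle> \<notin> T \<or> \<langle>x, y\<rangle> \<notin> T \<and> \<langle>y, x\<rangle> \<in> T)"

definition transitive_on :: "'a set \<Rightarrow> 'a set \<Rightarrow> bool" where
  "transitive_on H T \<longleftrightarrow>
    (\<forall>x\<in>H. \<forall>y\<in>H. \<forall>z\<in>H. \<langle>x, y\<rangle> \<in> T \<and> \<langle>y, z\<rangle> \<in> T \<longrightarrow> \<langle>x, z\<rangle> \<in> T)"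

definition em :: bool where
  "em \<longleftrightarrow> (\<forall>D\<in>Sets M. \<forall>T\<in>Sets M. unbounded D \<and> tournament D T \<longrightarrow>
    (\<exists>H\<in>Sets M. unbounded H \<and> H \<subseteq> D \<and> transitive_on H T))"

lemma sat_EM: "sat M e E EM \<longleftrightarrow> em"
  by (simp add: EM_def em_def sat_Inf_set[of M, folded unbounded_def] sat_Subset numeral_2_eq_2
      sat_Tournament[of M, folded tournament_def] sat_Transitive_on[of M, folded transitive_on_def])

text \<open>Orienting forward exactly the pairs that avoid \<open>c\<close> and applying
  \<open>em\<close> gives a transitive \<open>K\<close>, which may still contain backward arrows. It
  is thinned to the elements that receive arrows from all smaller elements of \<open>K\<close>;
  \<open>lim\<close> keeps these unbounded.\<close>

lemma homogeneous_set:
  assumes em: "em" and F: "F \<in> Sets M" and H: "H \<in> Sets M" "unbounded H"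
    and lim: "\<And>x. x \<in> H \<Longrightarrow> \<exists>b. \<forall>s. x \<prec> s \<and> b \<prec> s \<longrightarrow> \<langle>\<langle>x, s\<rangle>, c\<rangle> \<notin> F"
  shows "\<exists>A\<in>Sets M. unbounded A \<and> (\<forall>x\<in>A. \<forall>s\<in>A. x \<prec> s \<longrightarrow> \<langle>\<langle>x, s\<rangle>, c\<rangle> \<notin> F)"
proof -
  have ord: "x \<prec> y \<or> x = y \<or> y \<prec> x" "x \<prec> y \<Longrightarrow> \<not> y \<prec> x" "\<not> x \<prec> x" for x y
    using less_linear less_irrefl less_trans by blast+
  have "\<exists>T\<in>Sets M. (\<forall>n\<in>T. \<exists>x s. n = \<langle>x, s\<rangle>) \<and> (\<forall>x s. \<langle>x, s\<rangle> \<in> T \<longleftrightarrow> x \<in> H \<and> s \<in> H \<and>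
      (x \<prec> s \<and> \<langle>\<langle>x, s\<rangle>, c\<rangle> \<notin> F \<or> s \<prec> x \<and> \<langle>\<langle>s, x\<rangle>, c\<rangle> \<in> F))"
  proof -
    \<comment> \<open>Number indices 0 to 3 stand for z, s, x, c, and set indices 0 and 1 for
      \<open>F\<close> and \<open>H\<close>. No witness is searched for, so \<open>z\<close> is a
      dummy and the complement is the plain negation.\<close>
    let ?p = "v 2 \<^bold>\<in> 1 \<^bold>\<and> v 1 \<^bold>\<in> 1 \<^bold>\<and>
      (v 2 \<^bold>< v 1 \<^bold>\<and> \<^bold>\<not> val 0 (v 2) (v 1) (v 3) \<^bold>\<or> v 1 \<^bold>< v 2 \<^bold>\<and> val 0 (v 1) (v 2) (v 3))"
    let ?E = "case_nat F (\<lambda>_. H)"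
    have p: "sat M (case_nat z (case_nat s (case_nat x (\<lambda>_. c)))) ?E ?p \<longleftrightarrow> x \<in> H \<and> s \<in> H \<and>
        (x \<prec> s \<and> \<langle>\<langle>x, s\<rangle>, c\<rangle> \<notin> F \<or> s \<prec> x \<and> \<langle>\<langle>s, x\<rangle>, c\<rangle> \<in> F)" for x s z
      by (auto simp: numeral_2_eq_2 numeral_3_eq_3)
    have bd: "bounded ?p" "bounded (\<^bold>\<not> ?p)"
      by (simp_all add: bounded_all_intros)
    have E: "range ?E \<subseteq> Sets M"
      using F H(1) by (auto split: nat.splits)
    have "(\<exists>z. sat M (case_nat z (case_nat s (case_nat x (\<lambda>_. c)))) ?E ?p) \<longleftrightarrow>
        \<not> (\<exists>z. sat M (case_nat z (case_nat s (case_nat x (\<lambda>_. c)))) ?E (\<^bold>\<not> ?p))" for x s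
      by (auto simp: numeral_2_eq_2 numeral_3_eq_3)
    from pair_comprehension[OF bd E this] show ?thesis unfolding p by simp
  qed
  then obtain T where T: "T \<in> Sets M" "\<And>n. n \<in> T \<Longrightarrow> \<exists>x s. n = \<langle>x, s\<rangle>"
    "\<And>x s. \<langle>x, s\<rangle> \<in> T \<longleftrightarrow> x \<in> H \<and> s \<in> H \<and>
      (x \<prec> s \<and> \<langle>\<langle>x, s\<rangle>, c\<rangle> \<notin> F \<or> s \<prec> x \<and> \<langle>\<langle>s, x\<rangle>, c\<rangle> \<in> F)" by blast
  have "tournament H T"
    unfolding tournament_def T(3)
  proof (intro conjI)
    show "T \<subseteq> {\<langle>x, y\<rangle> | x y. x \<in> H \<and> y \<in> H}" using T(2,3) by blast
  qed (use ord in blast)+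
  then obtain K where K: "K \<in> Sets M" "K \<subseteq> H" "unbounded K" and trans: "transitive_on K T"
    using em T(1) H unfolding em_def by blast
  have total: "x = y \<or> \<langle>x, y\<rangle> \<in> T \<or> \<langle>y, x\<rangle> \<in> T" if "x \<in> K" "y \<in> K" for x y
    using \<open>tournament H T\<close> that K(2) unfolding tournament_def by blast
  have transD: "\<langle>x, z\<rangle> \<in> T" if "x \<in> K" "y \<in> K" "z \<in> K" "\<langle>x, y\<rangle> \<in> T" "\<langle>y, z\<rangle> \<in> T" for x y z
    using trans that unfolding transitive_on_def by blast
  have range: "range (case_nat T (\<lambda>_. K)) \<subseteq> Sets M"
    using T(1) K(1) by (auto split: nat.splits)
  define A where "A = {s \<in> K. \<forall>x. x \<in> K \<longrightarrow> x \<prec> s \<longrightarrow> \<langle>x, s\<rangle> \<in> T}"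
  have "A \<in> Sets M"
  proof -
    have "{s. sat M (case_nat s (\<lambda>_. c)) (case_nat T (\<lambda>_. K))
        (v 0 \<^bold>\<in> 1 \<^bold>\<and> BAll (v 0) (v 0 \<^bold>\<in> 1 \<^bold>\<longrightarrow> pair (v 0) (v 1) \<^bold>\<in> 0))} \<in> Sets M"
      by (rule bounded_comprehension[OF _ range]) (simp add: bounded_all_intros)
    then show ?thesis by (simp add: A_def)
  qed
  moreover have "unbounded A"
    unfolding unbounded_def
  proof
    fix n
    \<comment> \<open>\<open>m\<close> receives arrows from all other elements of \<open>K\<close>
      below \<open>k\<close>. It need not lie below \<open>k\<close> itself: at zero any element of
      \<open>K\<close> serves.\<close>
    have "\<exists>m. sat M (case_nat m (case_nat k (\<lambda>_. c))) (case_nat T (\<lambda>_. K))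
        (v 0 \<^bold>\<in> 1 \<^bold>\<and> BAll (v 1) (v 0 \<^bold>\<in> 1 \<^bold>\<longrightarrow> v 0 \<^bold>= v 1 \<^bold>\<or> pair (v 0) (v 1) \<^bold>\<in> 0))" for k
    proof (rule sigma_induct[OF _ range], goal_cases)
      case 2
      then show ?case using K(3) by (auto simp: unbounded_def not_less_zero)
    next
      case (3 k)
      then obtain m where m: "m \<in> K" "\<And>x. x \<prec> k \<Longrightarrow> x \<in> K \<Longrightarrow> x = m \<or> \<langle>x, m\<rangle> \<in> T" by auto
      have "\<exists>m\<in>K. \<forall>x. x \<prec> k \<oplus> \<one> \<longrightarrow> x \<in> K \<longrightarrow> x = m \<or> \<langle>x, m\<rangle> \<in> T"
      \<comment> \<open>\<open>k\<close> replaces \<open>m\<close> exactly if it lies in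
        \<open>K\<close> and m -> k; transitivity then carries the older elements over.\<close>
      proof (cases "k \<in> K \<and> \<langle>m, k\<rangle> \<in> T")
        case True
        then have "x = k \<or> \<langle>x, k\<rangle> \<in> T" if "x \<prec> k \<or> x = k" "x \<in> K" for x
          using m(2)[of x] transD[of x m k] m(1) that by blast
        then show ?thesis using True less_succ by blast
      next
        case False
        then have "x = m \<or> \<langle>x, m\<rangle> \<in> T" if "x \<prec> k \<or> x = k" "x \<in> K" for x
          using m(2)[of x] total[of m k] m(1) that by blast
        then show ?thesis using m(1) less_succ by blast
      qed
      then show ?case by auto
    qed (simp add: bounded_all_intros)
    \<comment> \<open>Let \<open>m\<close> dominate the part of \<open>K\<close> up to \<open>n\<close>; then the numerically least element
      \<open>s > n\<close> of \<open>K\<close> with \<open>m \<rightarrow> s\<close> lies in \<open>A\<close>.\<close>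
    from this[of "n \<oplus> \<one>"] obtain m where m: "m \<in> K" "\<And>x. x \<prec> n \<or> x = n \<Longrightarrow> x \<in> K \<Longrightarrow> x = m \<or> \<langle>x, m\<rangle> \<in> T"
      by (auto simp: less_succ)
    define X where "X = {s \<in> K. n \<prec> s \<and> \<langle>m, s\<rangle> \<in> T}"
    have "X \<in> Sets M"
    proof -
      have "{s. sat M (case_nat s (case_nat n (\<lambda>_. m))) (case_nat T (\<lambda>_. K))
          (v 0 \<^bold>\<in> 1 \<^bold>\<and> v 1 \<^bold>< v 0 \<^bold>\<and> pair (v 2) (v 0) \<^bold>\<in> 0)} \<in> Sets M"
        by (rule bounded_comprehension[OF _ range]) (simp add: bounded_all_intros)
      then show ?thesis by (simp add: X_def numeral_2_eq_2)
    qed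
    moreover have "\<exists>s. s \<in> X"
    proof -
      obtain b where b: "\<And>s. m \<prec> s \<Longrightarrow> b \<prec> s \<Longrightarrow> \<langle>\<langle>m, s\<rangle>, c\<rangle> \<notin> F"
        using lim[of m] m(1) K(2) by blast
      \<comment> \<open>An element beyond the sum is beyond each of \<open>n\<close>,
        \<open>m\<close> and \<open>b\<close>; by \<open>lim\<close>, the arrow from
        \<open>m\<close> to it points forward.\<close>
      obtain s where s: "s \<in> K" "n \<oplus> (m \<oplus> b) \<prec> s"
        using K(3) unfolding unbounded_def by blast
      then have "n \<prec> s" "m \<prec> s" "b \<prec> s"
        using less_addD by blast+
      then have "s \<in> X" using s(1) b m(1) K(2) by (auto simp: X_def T(3))
      then show ?thesis ..
    qed
    ultimately obtain s where s: "s \<in> X" "\<And>y. y \<prec> s \<Longrightarrow> y \<notin> X"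
      using least_element by blast
    have "\<langle>x, s\<rangle> \<in> T" if x: "x \<prec> s" "x \<in> K" for x
    proof -
      \<comment> \<open>Above \<open>n\<close>, minimality of \<open>s\<close> excludes m -> x, so
        totality applies; up to \<open>n\<close>, the choice of \<open>m\<close> applies. Together
        with m -> s this gives x -> s.\<close>
      have "x = m \<or> \<langle>x, m\<rangle> \<in> T"
      proof (cases "n \<prec> x")
        case True
        then have "\<langle>m, x\<rangle> \<notin> T" using s(2)[of x] x by (auto simp: X_def)
        then show ?thesis using total m(1) x(2) by blast
      next
        case False
        then show ?thesis using m(2) x(2) ord(1) by blast
      qed
      then show ?thesis
        using transD[of x m s] s(1) x(2) m(1) by (auto simp: X_def)
    qed
    then have "s \<in> A" "n \<prec> s" using s(1) by (auto simp: A_def X_def)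
    then show "\<exists>y\<in>A. n \<prec> y" by blast
  qed
  moreover have "\<langle>\<langle>x, s\<rangle>, c\<rangle> \<notin> F" if "x \<in> A" "s \<in> A" "x \<prec> s" for x s
  proof -
    have "\<langle>x, s\<rangle> \<in> T" using that by (auto simp: A_def)
    then show ?thesis using that(3) ord(2) unfolding T(3) by blast
  qed
  ultimately show ?thesis by blast
qed

text \<open>The colour \<open>2i\<close> stands for the \<open>i\<close>-th set of the sequence \<open>R\<close>, the colour \<open>2i + 1\<close> for its
  complement.\<close>

definition in_half :: "'a set \<Rightarrow> 'a \<Rightarrow> 'a \<Rightarrow> bool" where
  "in_half R y s \<longleftrightarrow> (\<exists>i. i \<prec> y \<oplus> \<one> \<and>
    (y = i \<oplus> i \<and> \<langle>i, s\<rangle> \<in> R \<or> y = i \<oplus> i \<oplus> \<one> \<and> \<langle>i, s\<rangle> \<notin> R))"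

definition in_half_fm :: "nat \<Rightarrow> tm \<Rightarrow> tm \<Rightarrow> fm" where
  "in_half_fm R y s = BEx (Add y One)
    (lift_tm y \<^bold>= Add (v 0) (v 0) \<^bold>\<and> pair (v 0) (lift_tm s) \<^bold>\<in> R \<^bold>\<or>
     lift_tm y \<^bold>= Add (Add (v 0) (v 0)) One \<^bold>\<and> \<^bold>\<not> (pair (v 0) (lift_tm s) \<^bold>\<in> R))"

lemma bounded_in_half_fm: "bounded (in_half_fm R y s)"
  by (simp add: in_half_fm_def bounded_all_intros)

lemma sat_in_half_fm: "sat M e E (in_half_fm R y s) \<longleftrightarrow> in_half (E R) (eval M e y) (eval M e s)"
  by (auto simp: in_half_fm_def in_half_def)

lemma in_half_double: "in_half R (i \<oplus> i) s \<longleftrightarrow> \<langle>i, s\<rangle> \<in> R"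
proof -
  have "i \<prec> i \<oplus> i \<oplus> \<one>" by (rule less_double_succ)
  then show ?thesis
    unfolding in_half_def using double_inject double_neq_succ_double by metis
qed

lemma in_half_succ_double: "in_half R (i \<oplus> i \<oplus> \<one>) s \<longleftrightarrow> \<langle>i, s\<rangle> \<notin> R"
proof -
  have "i \<prec> i \<oplus> i \<oplus> \<one> \<oplus> \<one>" using less_double_succ less_succ by blast
  then show ?thesis
    unfolding in_half_def using double_inject double_neq_succ_double succ_inj by metis
qed

lemma em_thin_or_cohesive:
  assumes em: "em" and F: "F \<in> Sets M" and R: "R \<in> Sets M"
    and uniq: "\<And>x s. x \<prec> s \<Longrightarrow> \<exists>!y. \<langle>\<langle>x, s\<rangle>, y\<rangle> \<in> F"
    and stable: "\<And>x. \<exists>y b. \<forall>s. x \<prec> s \<and> b \<prec> s \<longrightarrow> \<langle>\<langle>x, s\<rangle>, y\<rangle> \<in> F"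
    and not_thin: "\<And>A c. A \<in> Sets M \<Longrightarrow> unbounded A \<Longrightarrow> \<exists>x\<in>A. \<exists>s\<in>A. x \<prec> s \<and> \<langle>\<langle>x, s\<rangle>, c\<rangle> \<in> F"
  shows "\<exists>C\<in>Sets M. unbounded C \<and> (\<forall>i. (\<exists>b. \<forall>x\<in>C. b \<prec> x \<longrightarrow> \<langle>i, x\<rangle> \<in> R) \<or>
    (\<exists>b. \<forall>x\<in>C. b \<prec> x \<longrightarrow> \<langle>i, x\<rangle> \<notin> R))"
proof -
  have ord: "x \<prec> y \<or> x = y \<or> y \<prec> x" "x \<prec> y \<Longrightarrow> \<not> y \<prec> x" "\<not> x \<prec> x" for x y
    using less_linear less_irrefl less_trans by blast+
  \<comment> \<open>\<open>y\<close> is the colour of the pair, found by an unbounded search. The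
    second clause reverses the orientation when the larger entry comes first.\<close>
  define rel where "rel x s y \<longleftrightarrow>
    x \<prec> s \<and> \<langle>\<langle>x, s\<rangle>, y\<rangle> \<in> F \<and> in_half R y s \<or>
    s \<prec> x \<and> \<langle>\<langle>s, x\<rangle>, y\<rangle> \<in> F \<and> \<not> in_half R y x" for x s y
  have "\<exists>T\<in>Sets M. (\<forall>n\<in>T. \<exists>x s. n = \<langle>x, s\<rangle>) \<and> (\<forall>x s. \<langle>x, s\<rangle> \<in> T \<longleftrightarrow> (\<exists>y. rel x s y))"
  proof -
    let ?p = "v 2 \<^bold>< v 1 \<^bold>\<and> val 0 (v 2) (v 1) (v 0) \<^bold>\<and> in_half_fm 1 (v 0) (v 1) \<^bold>\<or>
      v 1 \<^bold>< v 2 \<^bold>\<and> val 0 (v 1) (v 2) (v 0) \<^bold>\<and> \<^bold>\<not> in_half_fm 1 (v 0) (v 2)"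
    \<comment> \<open>The complement in existential form: the diagonal, or a colour with the
      opposite verdict. Since every pair has exactly one colour, exactly one of \<open>?p\<close>
      and \<open>?q\<close> has a witness.\<close>
    let ?q = "v 1 \<^bold>= v 2 \<^bold>\<or> v 2 \<^bold>< v 1 \<^bold>\<and> val 0 (v 2) (v 1) (v 0) \<^bold>\<and> \<^bold>\<not> in_half_fm 1 (v 0) (v 1) \<^bold>\<or>
      v 1 \<^bold>< v 2 \<^bold>\<and> val 0 (v 1) (v 2) (v 0) \<^bold>\<and> in_half_fm 1 (v 0) (v 2)"
    let ?E = "case_nat F (\<lambda>_. R)"
    have p: "sat M (case_nat y (case_nat s (case_nat x e))) ?E ?p \<longleftrightarrow> rel x s y" for x s y e
      by (auto simp: rel_def sat_in_half_fm numeral_2_eq_2)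
    have q: "sat M (case_nat y (case_nat s (case_nat x e))) ?E ?q \<longleftrightarrow> x = s \<or>
        x \<prec> s \<and> \<langle>\<langle>x, s\<rangle>, y\<rangle> \<in> F \<and> \<not> in_half R y s \<or>
        s \<prec> x \<and> \<langle>\<langle>s, x\<rangle>, y\<rangle> \<in> F \<and> in_half R y x" for x s y e
      by (auto simp: sat_in_half_fm numeral_2_eq_2)
    have E: "range ?E \<subseteq> Sets M"
      using F R by (auto split: nat.splits)
    have bd: "bounded ?p" "bounded ?q"
      by (simp_all add: bounded_all_intros bounded_in_half_fm)
    have "(\<exists>y. sat M (case_nat y (case_nat s (case_nat x (\<lambda>_. \<zero>)))) ?E ?p) \<longleftrightarrow>
        \<not> (\<exists>y. sat M (case_nat y (case_nat s (case_nat x (\<lambda>_. \<zero>)))) ?E ?q)" for x s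
      unfolding p q rel_def using ord(1)[of x s] ord(2)[of x s] ord(2)[of s x] ord(3)[of s] uniq[of x s] uniq[of s x] by metis
    from pair_comprehension[OF bd E this] show ?thesis unfolding p .
  qed
  then obtain T where T: "T \<in> Sets M" "\<And>n. n \<in> T \<Longrightarrow> \<exists>x s. n = \<langle>x, s\<rangle>"
    "\<And>x s. \<langle>x, s\<rangle> \<in> T \<longleftrightarrow> (\<exists>y. rel x s y)" by blast
  have T_less: "\<langle>x, s\<rangle> \<in> T \<longleftrightarrow> in_half R y s" "\<langle>s, x\<rangle> \<in> T \<longleftrightarrow> \<not> in_half R y s"
    if "x \<prec> s" "\<langle>\<langle>x, s\<rangle>, y\<rangle> \<in> F" for x s y
    unfolding T(3) rel_def using that uniq[of x s] ord(2) by blast+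
  have UNIV_Sets: "UNIV \<in> Sets M"
    using bounded_comprehension[of "v 0 \<^bold>= v 0" some_sets] range_some_sets
    by (simp add: bounded_all_intros)
  have unb_UNIV: "unbounded UNIV"
    unfolding unbounded_def using less_succ by blast
  have "tournament UNIV T"
    unfolding tournament_def
  proof (intro conjI ballI impI)
    show "T \<subseteq> {\<langle>x, y\<rangle> | x y. x \<in> UNIV \<and> y \<in> UNIV}" using T(2) by blast
    show "\<langle>x, x\<rangle> \<notin> T" for x using ord(3) by (simp add: T(3) rel_def)
    show "\<langle>x, y\<rangle> \<in> T \<and> \<langle>y, x\<rangle> \<notin> T \<or> \<langle>x, y\<rangle> \<notin> T \<and> \<langle>y, x\<rangle> \<in> T" if "x \<noteq> y" for x y
      using ord(1)[of x y] that uniq[of x y] uniq[of y x] T_less[of x y] T_less[of y x] by blast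
  qed
  then obtain H where H: "H \<in> Sets M" "unbounded H" and trans: "transitive_on H T"
    using em T(1) UNIV_Sets unb_UNIV unfolding em_def by blast
  \<comment> \<open>Otherwise each \<open>x\<close> in \<open>H\<close> has a limit colour other
    than \<open>c\<close>. By uniqueness of values \<open>c\<close> is eventually avoided at
    \<open>x\<close>, and \<open>homogeneous_set\<close> contradicts
    \<open>not_thin\<close>.\<close>
  have limit: "\<exists>x\<in>H. \<exists>b. \<forall>s. x \<prec> s \<and> b \<prec> s \<longrightarrow> \<langle>\<langle>x, s\<rangle>, c\<rangle> \<in> F" for c
  proof (rule ccontr)
    assume no: "\<not> ?thesis"
    have "\<exists>b. \<forall>s. x \<prec> s \<and> b \<prec> s \<longrightarrow> \<langle>\<langle>x, s\<rangle>, c\<rangle> \<notin> F" if "x \<in> H" for x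
    proof -
      obtain y b where y: "\<forall>s. x \<prec> s \<and> b \<prec> s \<longrightarrow> \<langle>\<langle>x, s\<rangle>, y\<rangle> \<in> F"
        using stable by blast
      with no that have "y \<noteq> c" by blast
      then show ?thesis using y uniq by blast
    qed
    from homogeneous_set[OF em F H this] show False
      using not_thin by blast
  qed
  have "(\<exists>b. \<forall>s\<in>H. b \<prec> s \<longrightarrow> \<langle>i, s\<rangle> \<in> R) \<or> (\<exists>b. \<forall>s\<in>H. b \<prec> s \<longrightarrow> \<langle>i, s\<rangle> \<notin> R)" for i
  proof -
    obtain x b where x: "x \<in> H" "\<And>s. x \<prec> s \<Longrightarrow> b \<prec> s \<Longrightarrow> \<langle>\<langle>x, s\<rangle>, i \<oplus> i\<rangle> \<in> F"
      using limit by blast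
    obtain y b' where y: "y \<in> H" "\<And>s. y \<prec> s \<Longrightarrow> b' \<prec> s \<Longrightarrow> \<langle>\<langle>y, s\<rangle>, i \<oplus> i \<oplus> \<one>\<rangle> \<in> F"
      using limit by blast
    \<comment> \<open>Beyond \<open>B\<close> both colours have settled, so arrows from
      \<open>x\<close> and \<open>y\<close> read off membership in the \<open>i\<close>-th set and
      in its complement.\<close>
    define B where "B = x \<oplus> b \<oplus> (y \<oplus> b')"
    have Tx: "\<langle>x, s\<rangle> \<in> T \<longleftrightarrow> \<langle>i, s\<rangle> \<in> R" and Ty: "\<langle>y, s\<rangle> \<in> T \<longleftrightarrow> \<langle>i, s\<rangle> \<notin> R" if "B \<prec> s" for s
    proof -
      have "x \<prec> s" "b \<prec> s" "y \<prec> s" "b' \<prec> s"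
        using that less_addD unfolding B_def by blast+
      then show "\<langle>x, s\<rangle> \<in> T \<longleftrightarrow> \<langle>i, s\<rangle> \<in> R" "\<langle>y, s\<rangle> \<in> T \<longleftrightarrow> \<langle>i, s\<rangle> \<notin> R"
        using x(2)[of s] y(2)[of s] T_less(1) by (simp_all add: in_half_double in_half_succ_double)
    qed
    \<comment> \<open>At B + 1, for instance, exactly one of the two points has an outgoing
      arrow.\<close>
    have "x \<noteq> y"
      using Tx Ty less_succ by blast
    then have "\<langle>x, y\<rangle> \<in> T \<or> \<langle>y, x\<rangle> \<in> T"
      using \<open>tournament UNIV T\<close> unfolding tournament_def by blast
    then show ?thesis
    proof
      assume xy: "\<langle>x, y\<rangle> \<in> T"
      \<comment> \<open>If \<open>s\<close> were outside the \<open>i\<close>-th set, then y -> s,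
        hence x -> s by transitivity, which puts \<open>s\<close> into that set.\<close>
      have "\<langle>i, s\<rangle> \<in> R" if "s \<in> H" "B \<prec> s" for s
        using trans x(1) y(1) xy that Tx Ty unfolding transitive_on_def by blast
      then show ?thesis by blast
    next
      assume yx: "\<langle>y, x\<rangle> \<in> T"
      have "\<langle>i, s\<rangle> \<notin> R" if "s \<in> H" "B \<prec> s" for s
        using trans x(1) y(1) yx that Tx Ty unfolding transitive_on_def by blast
      then show ?thesis by blast
    qed
  qed
  then show ?thesis using H by blast
qed

section \<open>From the combinatorics back to provability\<close>

lemma sat_EM_imp_STS2_or_COH: "sat M e E (EM \<^bold>\<longrightarrow> (STS2 \<^bold>\<or> COH))"
proof -
  have "sat M e E COH" if em: "em" and no_thin: "\<not> sat M e E STS2"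
  proof -
    obtain F where F: "F \<in> Sets M" "sat M e (case_nat F E) (Colouring 0)" "sat M e (case_nat F E) (Stable 0)"
      "\<And>A. A \<in> Sets M \<Longrightarrow> sat M e (case_nat A (case_nat F E)) (Inf_set 0) \<Longrightarrow>
        \<not> sat M e (case_nat A (case_nat F E)) (Thin 1 0)"
      using no_thin by (auto simp: STS2_def)
    have uniq: "\<exists>!y. \<langle>\<langle>x, s\<rangle>, y\<rangle> \<in> F" if "x \<prec> s" for x s
      using F(2) that by (simp add: sat_Colouring)
    have stable: "\<exists>y b. \<forall>s. x \<prec> s \<and> b \<prec> s \<longrightarrow> \<langle>\<langle>x, s\<rangle>, y\<rangle> \<in> F" for x
      using F(3) by (simp add: sat_Stable)
    have not_thin: "\<exists>x\<in>A. \<exists>s\<in>A. x \<prec> s \<and> \<langle>\<langle>x, s\<rangle>, c\<rangle> \<in> F" if "A \<in> Sets M" "unbounded A" for A c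
      using F(4)[of A] that by (simp add: sat_Inf_set sat_Thin unbounded_def)
    have "\<exists>C\<in>Sets M. sat M e (case_nat C (case_nat R E)) (Inf_set 0 \<^bold>\<and> Cohesive 1 0)"
      if "R \<in> Sets M" for R
      using em_thin_or_cohesive[OF em F(1) that uniq stable not_thin]
      by (simp add: sat_Inf_set sat_Cohesive unbounded_def)
    then show ?thesis by (simp add: COH_def)
  qed
  then show ?thesis by (simp add: sat_EM)
qed

end

theorem theorem4p17: "RCA0 \<turnstile> (EM \<^bold>\<longrightarrow> (STS2 \<^bold>\<or> COH))"
proof (rule completeness)
  show "bounded_vars 0 RCA0"
    unfolding RCA0_def by (rule bounded_vars_uclosure)
  have "uclosure (\<^bold>\<not> (Add (v 0) One \<^bold>= Zero)) \<in> RCA0"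
    "uclosure (Add (v 0) One \<^bold>= Add (v 1) One \<^bold>\<longrightarrow> v 0 \<^bold>= v 1) \<in> RCA0"
    unfolding RCA0_def basic_axioms_def by blast+
  then show "RCA0 \<turnstile> \<^bold>\<forall>\<^sub>N \<^bold>\<not> (Add (v 0) One \<^bold>= Zero)"
    "RCA0 \<turnstile> \<^bold>\<forall>\<^sub>N \<^bold>\<forall>\<^sub>N (Add (v 0) One \<^bold>= Add (v 1) One \<^bold>\<longrightarrow> v 0 \<^bold>= v 1)"
    \<comment> \<open>The two axioms have one and two free number indices and no set index, so their
      closures are literally these formulas.\<close>
    by (auto simp: uclosure_def numeral_2_eq_2 intro: Assm)
  fix M :: "nat L2_struct" and e E
  assume "range E \<subseteq> Sets M" and "\<forall>q\<in>RCA0. sat M e E q"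
  then interpret rca0_model M
    \<comment> \<open>Truth of a closure passes to the open axiom at every assignment, and the range
      of \<open>E\<close> shows that \<open>Sets M\<close> is nonempty.\<close>
    by unfold_locales (auto intro: sat_uclosureD)
  show "sat M e E (EM \<^bold>\<longrightarrow> (STS2 \<^bold>\<or> COH))"
    by (rule sat_EM_imp_STS2_or_COH)
qed

end
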